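(* (Poincaré inequality) Let $G$ be a compactly generated locally compact group of polynomial growth, with compact symmetric generating set $S$, and let $\mu$ be a courteous probability measure on $G$. Suppose that there is a constant $c>0$ such that $\frac{d\mu}{d\mathfrak m}\ge c$ on $S^2$. Let $x_0\in G$, $R\ge1$, $B=B(x_0,R)$, let $f:G\to\mathbb C$ be measurable and locally integrable, and put $f_B=\frac1{|B|}\int_B f\,d\mathfrak m$. Then $$\int_B |f(x)-f_B|^2\,d\mathfrak m(x)\ \le\ c^{-1}\,32\,R^2\,\frac{|2B|^2}{|B|^2}\int_{3B}|\nabla f|_{\mu,2}(x)^2\,d\mathfrak m(x).$$
   Context: $S$ is a compact symmetric ($S=S^{-1}$) subset of $G$ containing $1$ with $G=\bigcup_{n\ge1}S^n$, where $S^n=\{s_1\cdots s_n: s_i\in S\}$ and $S^0=\{1\}$. $\mathfrak m$ is the left Haar measure on $G$ normalized so that $\mathfrak m(S)=1$, and for a measurable set $A$, $|A|=\mathfrak m(A)$. For $x\in G$, $|x|=\min\{n: x\in S^n\}$ is the word length. $B(x,R)=\{y\in G: |x^{-1}y|\le R\}$, and for $a>0$, $aB(x,R)=B(x,aR)$. $G$ has polynomial growth if there are $C,d>0$ with $\mathfrak m(S^n)\le C n^d$ for all $n>0$. A probability measure $\mu$ on $G$ is courteous if: (i) $\mu$ has a continuous density $\frac{d\mu}{d\mathfrak m}$ with respect to $\mathfrak m$; (ii) $\mu(A)=\mu(A^{-1})$ for all measurable $A$; (iii) the support of $\mu$ generates $G$; (iv) $\mu$ has exponential tail: there is $c_\mu>0$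 with $\mu(\{x:|x|>t\})\le e^{-c_\mu t}$ for all sufficiently large $t$. The gradient is $|\nabla f|_{\mu,2}(x)=\sqrt{\int_G|f(xs)-f(x)|^2\,d\mu(s)}$. Integrals of non-negative functions are allowed to take the value $+\infty$. *)

theory Defs
  imports "HOL-Probability.Probability"
begin

text \<open>
  The group is a type of class \<^class>\<open>topological_group_add\<close>, the library's class of topological
  groups. It does \<^emph>\<open>not\<close> assume commutativity; only the notation is additive. Thus the product
  \<open>x y\<close>, the unit \<open>1\<close> and the inverse \<open>x\<inverse>\<close> of multiplicative notation are written
  \<open>x + y\<close>, \<open>0\<close> and \<open>- x\<close>, and the order of the summands matters throughout.
\<close>

section \<open>Word length and growth\<close>

definition word_power :: "'g::monoid_add set \<Rightarrow> nat \<Rightarrow> 'g set" where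
  "word_power S n = {sum_list ss | ss. length ss = n \<and> set ss \<subseteq> S}"

definition compact_symmetric_generating_set :: "'g::topological_group_add set \<Rightarrow> bool" where
  "compact_symmetric_generating_set S \<longleftrightarrow>
     compact S \<and> uminus ` S = S \<and> 0 \<in> S \<and> (\<Union>n\<in>{1..}. word_power S n) = UNIV"

definition word_length :: "'g::monoid_add set \<Rightarrow> 'g \<Rightarrow> nat" where
  "word_length S x = (LEAST n. x \<in> word_power S n)"

definition word_ball :: "'g::group_add set \<Rightarrow> 'g \<Rightarrow> real \<Rightarrow> 'g set" where
  "word_ball S x R = {y. real (word_length S (- x + y)) \<le> R}"

definition polynomial_growth :: "'g::topological_group_add set \<Rightarrow> 'g measure \<Rightarrow> bool" where
  "polynomial_growth S m \<longleftrightarrow>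
     (\<exists>C>0. \<exists>d>0. \<forall>n>0. emeasure m (word_power S n) \<le> ennreal (C * real n powr d))"

section \<open>Haar measure\<close>

text \<open>
  Haar measures are nonzero left-invariant Radon measures on the Borel sets. The regularity
  conditions are not automatic here, because the topology need not be second countable.
\<close>

definition left_haar_measure :: "'g::{topological_group_add,t2_space} measure \<Rightarrow> bool" where
  "left_haar_measure m \<longleftrightarrow>
     sets m = sets borel \<and>
     emeasure m UNIV \<noteq> 0 \<and>
     (\<forall>g. \<forall>A\<in>sets borel. emeasure m ((\<lambda>x. g + x) ` A) = emeasure m A) \<and>
     (\<forall>K. compact K \<longrightarrow> emeasure m K < \<infinity>) \<and>
     (\<forall>A\<in>sets borel. emeasure m A = (INF U\<in>{U. open U \<and> A \<subseteq> U}. emeasure m U)) \<and>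
     (\<forall>U. open U \<longrightarrow> emeasure m U = (SUP K\<in>{K. compact K \<and> K \<subseteq> U}. emeasure m K))"

definition locally_integrable :: "'g::topological_space measure \<Rightarrow> ('g \<Rightarrow> complex) \<Rightarrow> bool" where
  "locally_integrable m f \<longleftrightarrow> (\<forall>K. compact K \<longrightarrow> set_integrable m K f)"

section \<open>Courteous measures\<close>

text \<open>A continuous density with respect to a Haar measure is unique, not just almost everywhere.\<close>

definition continuous_density ::
    "'g::topological_space measure \<Rightarrow> 'g measure \<Rightarrow> ('g \<Rightarrow> real) \<Rightarrow> bool" where
  "continuous_density m \<mu> \<phi> \<longleftrightarrow>
     continuous_on UNIV \<phi> \<and> (\<forall>x. 0 \<le> \<phi> x) \<and> \<mu> = density m (\<lambda>x. ennreal (\<phi> x))"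

definition measure_support :: "'g::topological_space measure \<Rightarrow> 'g set" where
  "measure_support \<mu> = {x. \<forall>U. open U \<and> x \<in> U \<longrightarrow> emeasure \<mu> U > 0}"

inductive_set generated_subgroup :: "'g::group_add set \<Rightarrow> 'g set" for A where
  zero: "0 \<in> generated_subgroup A"
| base: "a \<in> A \<Longrightarrow> a \<in> generated_subgroup A"
| add: "x \<in> generated_subgroup A \<Longrightarrow> y \<in> generated_subgroup A \<Longrightarrow> x + y \<in> generated_subgroup A"
| minus: "x \<in> generated_subgroup A \<Longrightarrow> - x \<in> generated_subgroup A"

definition courteous ::
    "'g::topological_group_add set \<Rightarrow> 'g measure \<Rightarrow> 'g measure \<Rightarrow> bool" where
  "courteous S m \<mu> \<longleftrightarrow>
     (\<exists>\<phi>. continuous_density m \<mu> \<phi>) \<and>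
     (\<forall>A\<in>sets \<mu>. emeasure \<mu> A = emeasure \<mu> (uminus ` A)) \<and>
     generated_subgroup (measure_support \<mu>) = UNIV \<and>
     (\<exists>c>0. eventually (\<lambda>t::real.
        emeasure \<mu> {x. real (word_length S x) > t} \<le> ennreal (exp (- c * t))) at_top)"

section \<open>Gradient\<close>

definition ennreal_sqrt :: "ennreal \<Rightarrow> ennreal" where
  "ennreal_sqrt a = (if a = \<infinity> then \<infinity> else ennreal (sqrt (enn2real a)))"

definition gradient2 :: "'g::monoid_add measure \<Rightarrow> ('g \<Rightarrow> complex) \<Rightarrow> 'g \<Rightarrow> ennreal" where
  "gradient2 \<mu> f x = ennreal_sqrt (\<integral>\<^sup>+ s. ennreal ((cmod (f (x + s) - f x))\<^sup>2) \<partial>\<mu>)"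

definition set_average :: "'g measure \<Rightarrow> 'g set \<Rightarrow> ('g \<Rightarrow> complex) \<Rightarrow> complex" where
  "set_average m B f = (LINT x:B|m. f x) /\<^sub>R measure m B"

end

theory Submission
  imports Defs
begin

text \<open>
  For \<open>n = \<lfloor>R\<rfloor>\<close>, Jensen's inequality bounds the variance over \<open>B = x\<^sub>0 S\<^sup>n\<close> by an integral of
  \<open>|f(x z) - f(x)|\<^sup>2\<close> over \<open>z \<in> S\<^sup>2\<^sup>n\<close> and \<open>x, x z \<in> B\<close>. Telescoping along a word of length \<open>2n\<close> for
  \<open>z\<close>, whose intermediate points stay in \<open>x\<^sub>0 S\<^sup>2\<^sup>n\<close>, and right invariance (polynomial growth forces
  unimodularity) reduce this to displacements by single generators. Those are averaged over
  an intermediate point in \<open>y S\<close> and then dominated by the gradient, as \<open>d\<mu>/dm \<ge> c\<close> on \<open>S\<^sup>2\<close>.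

  Fubini's theorem needs care: without second countability \<open>(x, z) \<mapsto> f(x z)\<close> need not be measurable
  for the product of the Borel \<open>\<sigma>\<close>-algebras. On a \<open>\<sigma>\<close>-compact group multiplication is however measurable
  for the Baire \<open>\<sigma>\<close>-algebras, and every Borel function agrees with a Baire function almost
  everywhere; by translation invariance, changing \<open>f\<close> on a null set does not affect the iterated
  integrals.
\<close>

section \<open>The Baire \<open>\<sigma>\<close>-algebra of a \<open>\<sigma>\<close>-compact group\<close>

text \<open>The smallest sigma-algebra making every continuous real function measurable. The
  threshold 0 covers all thresholds, because \<open>h - a\<close> is continuous along with
  \<open>h\<close>.\<close>

definition baire :: "'a::topological_space measure" where
  "baire = sigma UNIV {{x. 0 < h x} | h :: 'a \<Rightarrow> real. continuous_on UNIV h}"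

lemma space_baire [simp]: "space baire = UNIV"
  by (simp add: baire_def space_measure_of_conv)

lemma baire_positive_set: "continuous_on UNIV h \<Longrightarrow> {x. (0::real) < h x} \<in> sets baire"
  unfolding baire_def by (rule in_measure_of) auto

lemma continuous_imp_baire_measurable:
  fixes h :: "'a::topological_space \<Rightarrow> real"
  assumes "continuous_on UNIV h"
  shows "h \<in> borel_measurable baire"
proof (subst borel_measurable_iff_greater, rule allI)
  fix a
  have "{x. 0 < h x - a} \<in> sets baire"
    by (rule baire_positive_set) (intro continuous_intros assms)
  then show "{x \<in> space baire. a < h x} \<in> sets baire" by simp
qed

text \<open>The preimage of a generator is the positivity set of a composite \<open>h (f x)\<close>.
  Measurability of the group operations reduces to this test.\<close>

lemma measurable_baire:
  assumes "\<And>h :: 'b \<Rightarrow> real. continuous_on UNIV h \<Longrightarrow> (\<lambda>x. h (f x)) \<in> borel_measurable M"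
  shows "f \<in> measurable M (baire :: 'b::topological_space measure)"
  unfolding baire_def
proof (rule measurable_measure_of)
  fix A :: "'b set" assume "A \<in> {{x. 0 < h x} | h :: 'b \<Rightarrow> real. continuous_on UNIV h}"
  then obtain h :: "'b \<Rightarrow> real" where h: "continuous_on UNIV h" "A = {x. 0 < h x}" by auto
  have "(\<lambda>x. h (f x)) \<in> borel_measurable M" by (rule assms[OF h(1)])
  then have "{x \<in> space M. 0 < h (f x)} \<in> sets M" by simp
  then show "f -` A \<inter> space M \<in> sets M" by (simp add: h vimage_def Int_def conj_commute)
qed auto

lemma sets_baire_subset_borel: "sets (baire :: 'a::topological_space measure) \<subseteq> sets borel"
proof -
  have "{x. 0 < h x} \<in> sets borel" if "continuous_on UNIV h" for h :: "'a \<Rightarrow> real"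
    using borel_measurable_continuous_onI[OF that] by simp
  then have "sigma_sets UNIV {{x. 0 < h x} | h :: 'a \<Rightarrow> real. continuous_on UNIV h} \<subseteq> sets borel"
    by (intro sets.sigma_sets_subset[where M=borel, simplified]) auto
  then show ?thesis unfolding baire_def by (subst sets_measure_of) auto
qed

lemma measurable_continuous_baire:
  assumes "continuous_on UNIV (f :: 'a::topological_space \<Rightarrow> 'b::topological_space)"
  shows "f \<in> measurable baire baire"
  by (rule measurable_baire)
    (auto intro!: continuous_imp_baire_measurable continuous_on_compose2[OF _ assms])

lemma measurable_borel_baire: "(\<lambda>x. x) \<in> measurable borel (baire :: 'a::topological_space measure)"
  using sets_baire_subset_borel by (auto simp: measurable_def)

section \<open>Sigma-compact locally compact groups: Baire sets and measurability of
  addition\<close>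

locale sigma_compact_group =
  fixes K :: "nat \<Rightarrow> 'g::{topological_group_add,t2_space} set"
  assumes lc: "locally_compact_space (euclidean :: 'g topology)"
    and compact_K: "compact (K n)"
    and Union_K: "(\<Union>n. K n) = UNIV"
begin

lemma completely_regular: "completely_regular_space (euclidean :: 'g topology)"
proof -
  have "Hausdorff_space (euclidean :: 'g topology)"
    unfolding Hausdorff_space_def disjnt_def using hausdorff by fastforce
  then show ?thesis using lc locally_compact_regular_imp_completely_regular_space by blast
qed

lemma Urysohn_compact_open:
  fixes C U :: "'g set"
  assumes "compact C" "open U" "C \<subseteq> U"
  obtains h :: "'g \<Rightarrow> real" where "continuous_on UNIV h" "\<And>x. x \<in> C \<Longrightarrow> h x = 1" "\<And>x. x \<notin> U \<Longrightarrow> h x = 0"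
proof -
  have "compactin euclidean C" "closedin euclidean (-U)" "disjnt C (-U)"
    using assms by (auto simp: disjnt_iff closed_Compl)
  then obtain h where "continuous_map euclidean euclideanreal h" "h ` (-U) \<subseteq> {0}" "h ` C \<subseteq> {1}"
    by (rule Urysohn_completely_regular_compact_closed_alt[OF completely_regular])
  then show thesis by (intro that[of h]) auto
qed

text \<open>The positivity set of a Urysohn function is open and Baire at once. Through this
  interpolation, regularity of a measure, which speaks of compact and open sets, becomes usable for
  Baire sets.\<close>

lemma baire_between:
  fixes C U :: "'g set"
  assumes "compact C" "open U" "C \<subseteq> U"
  obtains Z where "Z \<in> sets baire" "open Z" "C \<subseteq> Z" "Z \<subseteq> U"
proof -
  obtain h :: "'g \<Rightarrow> real" where h: "continuous_on UNIV h" "\<And>x. x \<in> C \<Longrightarrow> h x = 1" "\<And>x. x \<notin> U \<Longrightarrow> h x = 0"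
    using Urysohn_compact_open[OF assms] by metis
  show thesis
  proof
    show "{x. 0 < h x} \<in> sets baire" by (rule baire_positive_set) fact
    show "open {x. 0 < h x}" using h(1) by (intro open_Collect_less) auto
    show "C \<subseteq> {x. 0 < h x}" "{x. 0 < h x} \<subseteq> U" using h(2,3) by (auto, force)
  qed
qed

text \<open>A countable union of countable intersections of finite unions of Baire rectangles
  realises a closed superlevel set, although the product topology has no countable base.\<close>

lemma continuous_imp_baire_pair_measurable:
  fixes F :: "'g \<times> 'g \<Rightarrow> real"
  assumes F: "continuous_on UNIV F"
  shows "F \<in> borel_measurable (baire \<Otimes>\<^sub>M baire)"
proof (subst borel_measurable_iff_ge, rule allI)
  fix a :: real
  have ex: "\<exists>W\<in>sets (baire \<Otimes>\<^sub>M baire). {p \<in> K n \<times> K n'. F p \<ge> a} \<subseteq> W \<and> W \<subseteq> {p. F p > b}"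
    if "b < a" for n n' b
  proof -
    define C where "C = {p \<in> K n \<times> K n'. F p \<ge> a}"
    have "closed {p. F p \<ge> a}" using F by (intro closed_Collect_le) auto
    then have "compact ((K n \<times> K n') \<inter> {p. F p \<ge> a})"
      by (intro compact_Int_closed compact_Times compact_K)
    then have C: "compact C" by (simp add: C_def Int_def)
    define V where "V = {p. F p > b}"
    have V: "open V" unfolding V_def using F by (intro open_Collect_less) auto
    \<comment> \<open>Open Baire rectangles inside \<open>V\<close> cover \<open>C\<close>, since
      each factor of a basic neighbourhood can be shrunk to an open Baire set. A finite subcover has
      a measurable union.\<close>
    define \<W> where "\<W> = {A \<times> B | A B. A \<in> sets baire \<and> B \<in> sets baire \<and> open A \<and> open B \<and> A \<times> B \<subseteq> V}"
    have "C \<subseteq> \<Union>\<W>"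
    proof
      fix p assume "p \<in> C"
      then have "p \<in> V" using that by (auto simp: C_def V_def)
      then obtain A B where AB: "open A" "open B" "p \<in> A \<times> B" "A \<times> B \<subseteq> V"
        using open_prod_elim[OF V] by metis
      obtain A' where A': "A' \<in> sets baire" "open A'" "{fst p} \<subseteq> A'" "A' \<subseteq> A"
        by (rule baire_between[of "{fst p}" A]) (use AB in auto)
      obtain B' where B': "B' \<in> sets baire" "open B'" "{snd p} \<subseteq> B'" "B' \<subseteq> B"
        by (rule baire_between[of "{snd p}" B]) (use AB in auto)
      have "A' \<times> B' \<in> \<W>" unfolding \<W>_def
        by (rule CollectI, rule exI[of _ A'], rule exI[of _ B'])
          (use A' B' AB(4) Sigma_mono[of A' A "\<lambda>_. B'" "\<lambda>_. B"] in simp)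
      moreover have "p \<in> A' \<times> B'" using A' B' by (simp add: mem_Times_iff)
      ultimately show "p \<in> \<Union>\<W>" by blast
    qed
    moreover have "\<forall>W\<in>\<W>. open W" by (auto simp: \<W>_def intro: open_Times)
    ultimately obtain \<V> where \<V>: "\<V> \<subseteq> \<W>" "finite \<V>" "C \<subseteq> \<Union>\<V>"
      using C by (metis compactE)
    have "\<Union>\<V> \<in> sets (baire \<Otimes>\<^sub>M baire)"
      using \<V> by (intro sets.finite_Union) (auto simp: \<W>_def)
    moreover have "\<Union>\<V> \<subseteq> V" using \<V>(1) by (auto simp: \<W>_def)
    ultimately show ?thesis using \<V>(3) unfolding C_def V_def by blast
  qed
  define P where "P n n' k W \<longleftrightarrow> W \<in> sets (baire \<Otimes>\<^sub>M baire) \<and>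
    {p \<in> K n \<times> K n'. F p \<ge> a} \<subseteq> W \<and> W \<subseteq> {p. F p > a - 1 / Suc k}" for n n' k W
  have "\<exists>W. P n n' k W" for n n' k
    using ex[of "a - 1 / Suc k" n n'] unfolding P_def by auto
  then obtain W where PW: "\<And>n n' k. P n n' k (W n n' k)" by metis
  then have W: "\<And>n n' k. W n n' k \<in> sets (baire \<Otimes>\<^sub>M baire)"
    "\<And>n n' k. {p \<in> K n \<times> K n'. F p \<ge> a} \<subseteq> W n n' k" "\<And>n n' k. W n n' k \<subseteq> {p. F p > a - 1 / Suc k}"
    unfolding P_def by auto
  have F_ge: "F p \<ge> a" if "\<And>k. F p > a - 1 / Suc k" for p
  proof (rule ccontr)
    assume "\<not> F p \<ge> a"
    then obtain k where "inverse (Suc k) < a - F p" using reals_Archimedean[of "a - F p"] by auto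
    with that[of k] show False by (simp add: inverse_eq_divide)
  qed
  \<comment> \<open>Each \<open>W n n' k\<close> lies between the superlevel set on
    \<open>K n \<times> K n'\<close> and \<open>{p. F p > a - 1 / Suc k}\<close>, so intersecting
    over \<open>k\<close> leaves only points with \<open>F p \<ge> a\<close>.\<close>
  have "{p. a \<le> F p} = (\<Union>n n'. \<Inter>k. W n n' k)"
  proof (intro equalityI subsetI)
    fix p assume p: "p \<in> {p. a \<le> F p}"
    obtain n n' where "fst p \<in> K n" "snd p \<in> K n'" using Union_K by (metis UNIV_I UN_iff)
    then have "p \<in> {p \<in> K n \<times> K n'. F p \<ge> a}" using p by (simp add: mem_Times_iff)
    then show "p \<in> (\<Union>n n'. \<Inter>k. W n n' k)" using W(2)[of n n'] by blast
  next
    fix p assume "p \<in> (\<Union>n n'. \<Inter>k. W n n' k)"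
    then obtain n n' where "\<And>k. p \<in> W n n' k" by blast
    then have "F p > a - 1 / Suc k" for k using subsetD[OF W(3)[of n n' k], of p] by simp
    then show "p \<in> {p. a \<le> F p}" using F_ge by simp
  qed
  moreover have "(\<Union>n n'. \<Inter>k. W n n' k) \<in> sets (baire \<Otimes>\<^sub>M baire)"
    using W(1) by (intro sets.countable_UN' sets.countable_INT'') auto
  ultimately show "{p \<in> space (baire \<Otimes>\<^sub>M baire). a \<le> F p} \<in> sets (baire \<Otimes>\<^sub>M baire)"
    by (simp add: space_pair_measure)
qed

end

context sigma_compact_group begin

text \<open>A continuous real function composed with addition is continuous on pairs, hence
  measurable for the product of the Baire algebras. The later exchanges of integrals rest on this
  joint measurability.\<close>

lemma measurable_add_baire:
  "(\<lambda>p. fst p + snd p) \<in> measurable (baire \<Otimes>\<^sub>M baire) (baire :: 'g measure)"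
  by (rule measurable_baire)
    (auto intro!: continuous_imp_baire_pair_measurable continuous_on_compose2[of UNIV _ UNIV "\<lambda>p. fst p + snd p"]
      continuous_intros)

lemma measurable_baire_add [measurable (raw)]:
  assumes "f \<in> measurable M baire" "g \<in> measurable M (baire :: 'g measure)"
  shows "(\<lambda>x. f x + g x) \<in> measurable M baire"
  using measurable_compose[OF measurable_Pair[OF assms] measurable_add_baire] by simp

lemma measurable_baire_uminus [measurable (raw)]:
  assumes "f \<in> measurable M (baire :: 'g measure)"
  shows "(\<lambda>x. - f x) \<in> measurable M baire"
  using measurable_compose[OF assms measurable_continuous_baire[of uminus]]
  by (simp add: continuous_on_minus)

text \<open>Inner regularity exhausts \<open>U\<close> by compact sets up to 1/(n+1). Baire sets
  between these compact sets and \<open>U\<close> have a countable union of full measure in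
  \<open>U\<close>.\<close>

lemma open_ae_baire:
  fixes m :: "'g measure"
  assumes m: "sets m = sets borel"
    and inner: "\<And>U. open U \<Longrightarrow> emeasure m U = (SUP C\<in>{C. compact C \<and> C \<subseteq> U}. emeasure m C)"
    and U: "open U" "emeasure m U < \<infinity>"
  obtains A where "A \<in> sets baire" "A \<subseteq> U" "emeasure m (U - A) = 0"
proof -
  have "\<exists>Z. Z \<in> sets baire \<and> Z \<subseteq> U \<and> emeasure m U - 1 / Suc n \<le> emeasure m Z" for n
  \<comment> \<open>The strict approximation from below needs positive measure; for a null
    \<open>U\<close> the empty set serves.\<close>
  proof (cases "emeasure m U = 0")
    case True
    then show ?thesis by (intro exI[of _ "{}"]) auto
  next
    case False
    have "emeasure m U - ennreal (1 / Suc n) < emeasure m U"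
      using False U(2) by (intro ennreal_between) (auto simp: ennreal_zero_less_divide zero_less_iff_neq_zero)
    then obtain C where C: "compact C" "C \<subseteq> U" "emeasure m U - ennreal (1 / Suc n) < emeasure m C"
      unfolding inner[OF U(1)] by (auto simp: less_SUP_iff)
    obtain Z where "Z \<in> sets baire" "C \<subseteq> Z" "Z \<subseteq> U"
      using baire_between[OF C(1) U(1) C(2)] by metis
    then show ?thesis using C(3) emeasure_mono[of C Z m] sets_baire_subset_borel m
      by (intro exI[of _ Z]) (auto simp: subset_iff intro: less_imp_le order.strict_trans2)
  qed
  then obtain Z where Z: "\<And>n. Z n \<in> sets baire" "\<And>n. Z n \<subseteq> U"
    "\<And>n. emeasure m U - ennreal (1 / Suc n) \<le> emeasure m (Z n)" by metis
  have Zb: "Z n \<in> sets m" for n using Z(1) sets_baire_subset_borel m by blast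
  have Ub: "U \<in> sets m" using U m by simp
  define A where "A = (\<Union>n. Z n)"
  have Ab: "A \<in> sets m" "A \<subseteq> U" using Zb Z(2) by (auto simp: A_def)
  have "emeasure m (U - A) \<le> ennreal e" if e: "e > 0" for e :: real
  proof -
    obtain n where n: "1 / Suc n < e" using reals_Archimedean[OF e] by (auto simp: inverse_eq_divide)
    have "emeasure m (U - A) \<le> emeasure m (U - Z n)" using Zb Ub Ab by (intro emeasure_mono) (auto simp: A_def)
    also have "\<dots> = emeasure m U - emeasure m (Z n)"
      using U Zb Ub Z(2) emeasure_mono[OF Z(2) Ub, of n] by (intro emeasure_Diff) (auto simp: top_unique)
    also have "\<dots> \<le> ennreal (1 / Suc n)"
      using Z(3)[of n] U(2) by (cases "emeasure m U"; cases "emeasure m (Z n)") (auto simp: ennreal_minus)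
    also have "\<dots> \<le> ennreal e" using n by (intro ennreal_leI) simp
    finally show ?thesis .
  qed
  then have "emeasure m (U - A) = 0"
    using ennreal_le_epsilon[of 0 "emeasure m (U - A)"] by simp
  then show thesis using Ab Z(1) by (intro that[of A]) (auto simp: A_def)
qed

end

section \<open>Baire representatives of Borel sets and functions, up to null sets\<close>

locale sigma_compact_haar = sigma_compact_group K
  for K :: "nat \<Rightarrow> 'g::{topological_group_add,t2_space} set" +
  fixes m :: "'g measure"
  assumes haar: "left_haar_measure m"
begin

lemma sets_m [measurable_cong]: "sets m = sets borel"
  using haar by (simp add: left_haar_measure_def)

lemma space_m [simp]: "space m = UNIV"
  using sets_eq_imp_space_eq[OF sets_m] by simp

lemma compact_finite: "compact C \<Longrightarrow> emeasure m C < \<infinity>"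
  using haar by (simp add: left_haar_measure_def)

lemma outer: "A \<in> sets borel \<Longrightarrow> emeasure m A = (INF U\<in>{U. open U \<and> A \<subseteq> U}. emeasure m U)"
  using haar unfolding left_haar_measure_def by blast

lemma inner: "open U \<Longrightarrow> emeasure m U = (SUP C\<in>{C. compact C \<and> C \<subseteq> U}. emeasure m C)"
  using haar unfolding left_haar_measure_def by blast

lemma left_invariant: "A \<in> sets borel \<Longrightarrow> emeasure m ((+) g ` A) = emeasure m A"
  using haar by (simp add: left_haar_measure_def)

lemma compact_in_sets [simp]: "compact C \<Longrightarrow> C \<in> sets borel" for C :: "'g set"
  by (intro borel_closed compact_imp_closed)

sublocale sigma_finite_measure m
proof
  show "\<exists>A. countable A \<and> A \<subseteq> sets m \<and> \<Union>A = space m \<and> (\<forall>a\<in>A. emeasure m a \<noteq> \<infinity>)"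
    using compact_K Union_K compact_finite
    by (intro exI[of _ "range K"]) (auto simp: sets_m less_top)
qed

text \<open>Outer regularity gives open supersets within 1/(n+1) in measure. Each of them agrees up
  to a null set with a Baire subset, and the intersection of these Baire sets agrees with
  \<open>A\<close> almost everywhere.\<close>

lemma borel_ae_baire_finite:
  assumes A: "A \<in> sets borel" "emeasure m A < \<infinity>"
  shows "\<exists>A'\<in>sets baire. AE x in m. x \<in> A \<longleftrightarrow> x \<in> A'"
proof -
  have "\<exists>U. open U \<and> A \<subseteq> U \<and> emeasure m U < emeasure m A + ennreal (1 / Suc n)" for n
  proof -
    have "emeasure m A < emeasure m A + ennreal (1 / Suc n)"
      using A(2) by (simp add: ennreal_zero_less_divide ennreal_less_top)
    then show ?thesis by (subst (asm) outer[OF A(1)]) (auto simp: INF_less_iff)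
  qed
  then obtain U where U: "\<And>n. open (U n)" "\<And>n. A \<subseteq> U n"
    "\<And>n. emeasure m (U n) < emeasure m A + ennreal (1 / Suc n)" by metis
  have Ub: "U n \<in> sets m" for n using U(1) by (simp add: sets_m)
  have "\<forall>n. \<exists>V. V \<in> sets baire \<and> V \<subseteq> U n \<and> emeasure m (U n - V) = 0"
  proof
    fix n
    have "emeasure m (U n) < \<infinity>" using U(3)[of n] A(2) by (metis ennreal_add_less_top ennreal_less_top infinity_ennreal_def order.strict_trans)
    then show "\<exists>V. V \<in> sets baire \<and> V \<subseteq> U n \<and> emeasure m (U n - V) = 0"
      using open_ae_baire[OF sets_m inner U(1)] by metis
  qed
  then obtain V where V: "\<And>n. V n \<in> sets baire" "\<And>n. V n \<subseteq> U n" "\<And>n. emeasure m (U n - V n) = 0" by metis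
  have Vb: "V n \<in> sets m" for n using V(1) sets_baire_subset_borel sets_m by blast
  have [simp]: "A \<in> sets m" using A sets_m by simp
  have "emeasure m ((\<Inter>n. U n) - A) \<le> ennreal e" if e: "e > 0" for e :: real
  proof -
    obtain n where n: "1 / Suc n < e" using reals_Archimedean[OF e] by (auto simp: inverse_eq_divide)
    have "emeasure m ((\<Inter>n. U n) - A) \<le> emeasure m (U n - A)" using Ub by (intro emeasure_mono) auto
    also have "\<dots> = emeasure m (U n) - emeasure m A"
      using Ub U(2) A by (intro emeasure_Diff) auto
    also have "\<dots> \<le> ennreal (1 / Suc n)"
      using U(3)[of n] by (intro ennreal_minus_le_iff[THEN iffD2]) auto
    also have "\<dots> \<le> ennreal e" using n by (intro ennreal_leI) simp
    finally show ?thesis .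
  qed
  then have "emeasure m ((\<Inter>n. U n) - A) = 0"
    using ennreal_le_epsilon[of 0 "emeasure m ((\<Inter>n. U n) - A)"] by simp
  then have 1: "AE x in m. x \<notin> (\<Inter>n. U n) - A"
    using Ub by (intro AE_not_in null_setsI) auto
  have "AE x in m. x \<notin> U n - V n" for n
    using V(3) Ub Vb by (intro AE_not_in null_setsI sets.Diff)
  then have 2: "AE x in m. \<forall>n. x \<notin> U n - V n"
    unfolding AE_all_countable by blast
  show ?thesis
  proof (rule bexI)
    show "(\<Inter>n. V n) \<in> sets baire" using V(1) by auto
    show "AE x in m. (x \<in> A) = (x \<in> (\<Inter>n. V n))"
      using 1 2 by eventually_elim (use U(2) V(2) in blast)
  qed
qed

text \<open>The pieces \<open>A \<inter> K n\<close> have finite measure, and countably many null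
  sets may be discarded together.\<close>

lemma borel_ae_baire:
  assumes A: "A \<in> sets borel"
  shows "\<exists>A'\<in>sets baire. AE x in m. x \<in> A \<longleftrightarrow> x \<in> A'"
proof -
  have "\<forall>n. \<exists>A'\<in>sets baire. AE x in m. x \<in> A \<inter> K n \<longleftrightarrow> x \<in> A'"
  proof
    fix n
    have "emeasure m (A \<inter> K n) \<le> emeasure m (K n)"
      using compact_K by (intro emeasure_mono) (auto simp: sets_m)
    then show "\<exists>A'\<in>sets baire. AE x in m. x \<in> A \<inter> K n \<longleftrightarrow> x \<in> A'"
      using compact_finite[OF compact_K] A compact_K by (intro borel_ae_baire_finite) (auto intro: le_less_trans)
  qed
  then obtain A' where A': "\<And>n. A' n \<in> sets baire" "\<And>n. AE x in m. x \<in> A \<inter> K n \<longleftrightarrow> x \<in> A' n" by metis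
  have "AE x in m. \<forall>n. x \<in> A \<inter> K n \<longleftrightarrow> x \<in> A' n" using A'(2) by (subst AE_all_countable) auto
  then have "AE x in m. x \<in> A \<longleftrightarrow> x \<in> (\<Union>n. A' n)"
    by eventually_elim (use Union_K in blast)
  then show ?thesis using A'(1) by blast
qed

text \<open>Induction over the construction from indicators; in the supremum step only countably
  many exceptional null sets accumulate.\<close>

lemma borel_fun_ae_baire_ennreal:
  assumes "f \<in> borel_measurable borel"
  shows "\<exists>f'. f' \<in> borel_measurable baire \<and> (AE x in m. f x = (f' x :: ennreal))"
  using assms
proof (induction rule: borel_measurable_induct)
  case (cong f g)
  then show ?case by (metis (full_types) UNIV_I ext space_borel)
next
  case (set A)
  then obtain A' where "A' \<in> sets baire" "AE x in m. x \<in> A \<longleftrightarrow> x \<in> A'" using borel_ae_baire by blast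
  then show ?case
    by (intro exI[of _ "indicator A'"] conjI) (auto elim!: AE_mp simp: indicator_def)
next
  case (mult u c)
  then obtain u' where [measurable]: "u' \<in> borel_measurable baire" and "AE x in m. u x = u' x" by blast
  then show ?case by (intro exI[of _ "\<lambda>x. c * u' x"]) auto
next
  case (add u v)
  then obtain u' v' where [measurable]: "u' \<in> borel_measurable baire" "v' \<in> borel_measurable baire"
    and "AE x in m. u x = u' x" "AE x in m. v x = v' x" by blast
  then show ?case by (intro exI[of _ "\<lambda>x. v' x + u' x"]) auto
next
  case (seq U)
  then have "\<forall>i. \<exists>f'. f' \<in> borel_measurable baire \<and> (AE x in m. U i x = f' x)" by blast
  then obtain U' where [measurable]: "\<And>i. U' i \<in> borel_measurable baire" and "\<And>i. AE x in m. U i x = U' i x" by metis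
  then have "AE x in m. \<forall>i. U i x = U' i x" by (subst AE_all_countable) auto
  then have "AE x in m. (SUP i. U i) x = (SUP i. U' i x)" by eventually_elim (simp add: image_comp)
  then show ?case by (intro exI[of _ "\<lambda>x. SUP i. U' i x"]) auto
qed

lemma borel_fun_ae_baire_real:
  assumes [measurable]: "f \<in> borel_measurable borel"
  shows "\<exists>f'. f' \<in> borel_measurable baire \<and> (AE x in m. f x = (f' x :: real))"
proof -
  \<comment> \<open>\<open>ennreal\<close> sends negative reals to 0, so \<open>p\<close> and
    \<open>n\<close> represent the positive and the negative part of \<open>f\<close>.\<close>
  obtain p where [measurable]: "p \<in> borel_measurable baire" and p: "AE x in m. ennreal (f x) = p x"
    using borel_fun_ae_baire_ennreal[of "\<lambda>x. ennreal (f x)"] by auto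
  obtain n where [measurable]: "n \<in> borel_measurable baire" and n: "AE x in m. ennreal (- f x) = n x"
    using borel_fun_ae_baire_ennreal[of "\<lambda>x. ennreal (- f x)"] by auto
  have "AE x in m. f x = enn2real (p x) - enn2real (n x)"
    using p n by eventually_elim (metis enn2real_ennreal ennreal_neg diff_0_right diff_0 enn2real_0 linear minus_minus neg_le_0_iff_le)
  then show ?thesis by (intro exI[of _ "\<lambda>x. enn2real (p x) - enn2real (n x)"]) auto
qed

lemma borel_fun_ae_baire_complex:
  assumes [measurable]: "f \<in> borel_measurable borel"
  shows "\<exists>f'. f' \<in> borel_measurable baire \<and> (AE x in m. f x = (f' x :: complex))"
proof -
  obtain u where [measurable]: "u \<in> borel_measurable baire" and u: "AE x in m. Re (f x) = u x"
    using borel_fun_ae_baire_real[of "\<lambda>x. Re (f x)"] by auto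
  obtain v where [measurable]: "v \<in> borel_measurable baire" and v: "AE x in m. Im (f x) = v x"
    using borel_fun_ae_baire_real[of "\<lambda>x. Im (f x)"] by auto
  have "AE x in m. f x = Complex (u x) (v x)"
    using u v by eventually_elim (simp add: complex_eq_iff)
  moreover have "(\<lambda>x. Complex (u x) (v x)) \<in> borel_measurable baire"
    by (simp add: borel_measurable_complex_iff)
  ultimately show ?thesis by blast
qed

end

section \<open>Uniqueness of Haar measure and the modular function\<close>

text \<open>Invariance is phrased as a pushforward identity, which \<open>nn_integral_distr\<close>
  turns directly into a change of variables.\<close>

definition left_invariant :: "'g::topological_group_add measure \<Rightarrow> bool" where
  "left_invariant \<nu> \<longleftrightarrow> sets \<nu> = sets borel \<and> (\<forall>g. distr \<nu> borel ((+) g) = \<nu>)"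

lemma borel_measurable_left_translation [measurable]: "(+) g \<in> measurable borel borel"
  for g :: "'g::topological_group_add"
  by (intro borel_measurable_continuous_onI continuous_intros)

lemma borel_measurable_right_translation [measurable]: "(\<lambda>x. x + g) \<in> measurable borel borel"
  for g :: "'g::topological_group_add"
  by (intro borel_measurable_continuous_onI continuous_intros)

lemma borel_measurable_right_translation_diff [measurable]: "(\<lambda>x. x - g) \<in> measurable borel borel"
  for g :: "'g::topological_group_add"
  by (intro borel_measurable_continuous_onI continuous_intros)

lemma borel_measurable_group_uminus [measurable]:
  "(uminus :: 'g \<Rightarrow> 'g::topological_group_add) \<in> measurable borel borel"
  by (intro borel_measurable_continuous_onI continuous_intros)

lemma nn_integral_left_translation:
  assumes "left_invariant \<nu>" and [measurable]: "f \<in> borel_measurable borel"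
  shows "(\<integral>\<^sup>+x. f (g + x) \<partial>\<nu>) = (\<integral>\<^sup>+x. f x \<partial>\<nu>)"
proof -
  have [measurable_cong]: "sets \<nu> = sets borel" using assms(1) by (simp add: left_invariant_def)
  have "(\<integral>\<^sup>+x. f x \<partial>distr \<nu> borel ((+) g)) = (\<integral>\<^sup>+x. f (g + x) \<partial>\<nu>)"
    by (rule nn_integral_distr) auto
  then show ?thesis using assms(1) by (simp add: left_invariant_def)
qed

lemma measurable_baire_imp_borel: "f \<in> measurable baire M \<Longrightarrow> f \<in> measurable borel M"
  using measurable_compose[OF measurable_borel_baire] by blast

lemma measurable_imp_baire: "f \<in> measurable M borel \<Longrightarrow> f \<in> measurable M baire"
  using measurable_compose[OF _ measurable_borel_baire] by blast

context sigma_compact_group begin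

text \<open>The measure-preserving map \<open>(x, y) \<mapsto> (y x, x\<inverse>)\<close> of \<open>G \<times> G\<close> in integrated form.\<close>

lemma nn_integral_product_swap:
  fixes e f :: "'g \<Rightarrow> ennreal"
  assumes \<mu>: "left_invariant \<mu>" "sigma_finite_measure \<mu>"
    and \<nu>: "left_invariant \<nu>" "sigma_finite_measure \<nu>"
    and [measurable]: "e \<in> borel_measurable baire" "f \<in> borel_measurable baire"
  shows "(\<integral>\<^sup>+x. e x \<partial>\<mu>) * (\<integral>\<^sup>+y. f y \<partial>\<nu>) = (\<integral>\<^sup>+x. f (- x) * (\<integral>\<^sup>+y. e (y + x) \<partial>\<nu>) \<partial>\<mu>)"
proof -
  interpret \<mu>: sigma_finite_measure \<mu> by fact
  interpret \<nu>: sigma_finite_measure \<nu> by fact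
  interpret pair_sigma_finite \<mu> \<nu> ..
  have [measurable_cong]: "sets \<mu> = sets borel" "sets \<nu> = sets borel"
    using \<mu> \<nu> by (auto simp: left_invariant_def)
  have fst' [measurable]: "fst \<in> measurable (\<mu> \<Otimes>\<^sub>M \<nu>) baire" by (rule measurable_imp_baire) simp
  have snd' [measurable]: "snd \<in> measurable (\<mu> \<Otimes>\<^sub>M \<nu>) baire" by (rule measurable_imp_baire) simp
  have [measurable]: "f \<in> borel_measurable borel" "e \<in> borel_measurable borel"
    using assms by (auto intro: measurable_baire_imp_borel)
  have trans [measurable]: "(\<lambda>x. g (x + a)) \<in> borel_measurable borel" "(\<lambda>x. g (- x + a)) \<in> borel_measurable borel"
     if [measurable]: "g \<in> borel_measurable baire" for g :: "'g \<Rightarrow> ennreal" and a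
    by (rule measurable_baire_imp_borel, measurable)+
  have "(\<integral>\<^sup>+x. f (- x) * (\<integral>\<^sup>+y. e (y + x) \<partial>\<nu>) \<partial>\<mu>) = (\<integral>\<^sup>+x. \<integral>\<^sup>+y. f (- x) * e (y + x) \<partial>\<nu> \<partial>\<mu>)"
    by (intro nn_integral_cong nn_integral_cmult[symmetric]) measurable
  also have "\<dots> = (\<integral>\<^sup>+y. \<integral>\<^sup>+x. f (- x) * e (y + x) \<partial>\<mu> \<partial>\<nu>)"
    by (rule Fubini'[symmetric]) (simp add: split_beta')
  \<comment> \<open>For fixed \<open>y\<close>, left invariance of \<open>\<mu>\<close> replaces
    \<open>x\<close> by \<open>- y + x\<close>. After the integrals are exchanged again, left
    invariance of \<open>\<nu>\<close> removes \<open>- x\<close> from the argument of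
    \<open>f\<close>, and the double integral factors.\<close>
  also have "\<dots> = (\<integral>\<^sup>+y. \<integral>\<^sup>+x. f (- x + y) * e x \<partial>\<mu> \<partial>\<nu>)"
  proof (rule nn_integral_cong)
    fix y
    have "(\<integral>\<^sup>+x. f (- x + y) * e x \<partial>\<mu>) = (\<integral>\<^sup>+x. f (- (y + x) + y) * e (y + x) \<partial>\<mu>)"
      by (rule nn_integral_left_translation[OF \<mu>(1), symmetric]) measurable
    then show "(\<integral>\<^sup>+x. f (- x) * e (y + x) \<partial>\<mu>) = (\<integral>\<^sup>+x. f (- x + y) * e x \<partial>\<mu>)"
      by (simp add: minus_add add.assoc)
  qed
  also have "\<dots> = (\<integral>\<^sup>+x. \<integral>\<^sup>+y. f (- x + y) * e x \<partial>\<nu> \<partial>\<mu>)"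
    by (rule Fubini') (simp add: split_beta')
  also have "\<dots> = (\<integral>\<^sup>+x. (\<integral>\<^sup>+y. f (- x + y) \<partial>\<nu>) * e x \<partial>\<mu>)"
    by (intro nn_integral_cong nn_integral_multc) measurable
  also have "\<dots> = (\<integral>\<^sup>+x. (\<integral>\<^sup>+y. f y \<partial>\<nu>) * e x \<partial>\<mu>)"
    by (simp add: nn_integral_left_translation[OF \<nu>(1)])
  also have "\<dots> = (\<integral>\<^sup>+y. f y \<partial>\<nu>) * (\<integral>\<^sup>+x. e x \<partial>\<mu>)"
    by (rule nn_integral_cmult) measurable
  finally show ?thesis by (simp add: mult.commute)
qed

text \<open>The product identity is applied to the pairs (\<mu>, \<nu>) and (\<nu>, \<nu>) with the
  same \<open>f\<close>. The integrals of \<open>u\<close> against the two measures then share the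
  factor \<integral> f d\<nu>, so they are in the same proportion as the integrals of
  \<open>e\<close>.\<close>

lemma left_invariant_unique:
  fixes e u :: "'g \<Rightarrow> ennreal"
  assumes \<mu>: "left_invariant \<mu>" "sigma_finite_measure \<mu>"
    and \<nu>: "left_invariant \<nu>" "sigma_finite_measure \<nu>"
    and e [measurable]: "e \<in> borel_measurable baire"
    and u [measurable]: "u \<in> borel_measurable baire"
    and pos: "\<And>x. (\<integral>\<^sup>+y. e (y + x) \<partial>\<nu>) \<noteq> 0" and fin: "\<And>x. (\<integral>\<^sup>+y. e (y + x) \<partial>\<nu>) \<noteq> \<infinity>"
  shows "(\<integral>\<^sup>+x. e x \<partial>\<nu>) * (\<integral>\<^sup>+x. u x \<partial>\<mu>) = (\<integral>\<^sup>+x. e x \<partial>\<mu>) * (\<integral>\<^sup>+x. u x \<partial>\<nu>)"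
proof -
  interpret \<nu>: sigma_finite_measure \<nu> by fact
  have [measurable_cong]: "sets \<nu> = sets borel" using \<nu> by (auto simp: left_invariant_def)
  define w where "w x = (\<integral>\<^sup>+y. e (y + x) \<partial>\<nu>)" for x
  have snd': "snd \<in> measurable (baire \<Otimes>\<^sub>M \<nu>) baire" by (rule measurable_imp_baire) simp
  have fst': "fst \<in> measurable (baire \<Otimes>\<^sub>M \<nu>) baire" by simp
  have "(\<lambda>p. e (snd p + fst p)) \<in> borel_measurable (baire \<Otimes>\<^sub>M \<nu>)"
    by (rule measurable_compose[OF measurable_baire_add[OF snd' fst'] e])
  then have [measurable]: "w \<in> borel_measurable baire"
    unfolding w_def by (intro \<nu>.borel_measurable_nn_integral) (simp add: split_beta')
  \<comment> \<open>Chosen so that \<open>f (- x)\<close> cancels the weight \<open>w x\<close> and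
    leaves \<open>u x\<close>; this is where \<open>w\<close> must be nonzero and finite.\<close>
  define f where "f y = u (- y) / w (- y)" for y
  have [measurable]: "f \<in> borel_measurable baire" unfolding f_def by measurable
  have *: "f (- x) * w x = u x" for x
    using pos[of x] fin[of x] by (simp add: f_def w_def[symmetric] ennreal_divide_times ennreal_times_divide mult_divide_eq_ennreal)
  have "(\<integral>\<^sup>+x. u x \<partial>\<mu>) = (\<integral>\<^sup>+x. e x \<partial>\<mu>) * (\<integral>\<^sup>+y. f y \<partial>\<nu>)"
    using nn_integral_product_swap[OF \<mu> \<nu>, of e f] * by (simp add: w_def)
  moreover have "(\<integral>\<^sup>+x. u x \<partial>\<nu>) = (\<integral>\<^sup>+x. e x \<partial>\<nu>) * (\<integral>\<^sup>+y. f y \<partial>\<nu>)"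
    using nn_integral_product_swap[OF \<nu> \<nu>, of e f] * by (simp add: w_def)
  ultimately show ?thesis by (simp add: ac_simps)
qed

end

section \<open>Haar measure under right translation and inversion\<close>

context sigma_compact_haar begin

lemma left_invariant_m: "left_invariant m"
  unfolding left_invariant_def
proof (intro conjI allI sets_m)
  fix g
  show "distr m borel ((+) g) = m"
  proof (rule measure_eqI)
    fix A assume "A \<in> sets (distr m borel ((+) g))"
    then have A: "A \<in> sets borel" by simp
    have "(+) g -` A = (+) (- g) ` A"
      by (auto simp: image_iff) (metis add.assoc add.left_neutral left_minus)
    then show "emeasure (distr m borel ((+) g)) A = emeasure m A"
      using A left_invariant[OF A, of "- g"] by (subst emeasure_distr) auto
  qed (simp add: sets_m)
qed

lemma emeasure_UNIV_nonzero: "emeasure m UNIV \<noteq> 0"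
  using haar unfolding left_haar_measure_def by blast

text \<open>If \<open>U\<close> were null, finitely many of its left translates, all null, would
  cover each \<open>K n\<close>, and the whole group would be null.\<close>

lemma open_positive:
  assumes U: "open U" "U \<noteq> {}"
  shows "emeasure m U \<noteq> 0"
proof
  assume 0: "emeasure m U = 0"
  obtain u where u: "u \<in> U" using U by blast
  have op: "open ((+) g ` U)" for g
  proof -
    have "(+) g ` U = (+) (- g) -` U"
      by (auto simp: image_iff) (metis add.assoc add.left_neutral right_minus)
    then show ?thesis by (simp add: U open_vimage continuous_intros)
  qed
  have "emeasure m (K n) = 0" for n
  proof -
    have "K n \<subseteq> (\<Union>g\<in>UNIV. (+) g ` U)"
    proof
      fix x assume "x \<in> K n"
      have "x = (x - u) + u" by simp
      then show "x \<in> (\<Union>g\<in>UNIV. (+) g ` U)" using u by blast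
    qed
    then obtain C where C: "finite C" "K n \<subseteq> (\<Union>g\<in>C. (+) g ` U)"
      using compactE_image[OF compact_K, of UNIV "\<lambda>g. (+) g ` U"] op by metis
    have "emeasure m (K n) \<le> emeasure m (\<Union>g\<in>C. (+) g ` U)"
      using C op by (intro emeasure_mono) (auto simp: sets_m)
    also have "\<dots> \<le> (\<Sum>g\<in>C. emeasure m ((+) g ` U))"
      using C op by (intro emeasure_subadditive_finite) (auto simp: sets_m)
    also have "\<dots> = 0" using 0 left_invariant[of U] U by simp
    finally show ?thesis by simp
  qed
  then have "emeasure m (\<Union>n. K n) = 0"
    using compact_K by (intro emeasure_UN_eq_0) (auto simp: sets_m)
  then show False using Union_K emeasure_UNIV_nonzero by simp
qed

lemma compact_right_translation: "compact C \<Longrightarrow> compact ((\<lambda>x. x + g) ` C)" for C :: "'g set"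
  by (intro compact_continuous_image continuous_intros)

lemma open_right_translation: "open U \<Longrightarrow> open ((\<lambda>x. x + g) ` U)" for U :: "'g set"
proof -
  assume "open U"
  moreover have "(\<lambda>x. x + g) ` U = (\<lambda>x. x - g) -` U"
    by (auto simp: image_iff) (metis diff_add_cancel)
  ultimately show ?thesis by (simp add: open_vimage continuous_intros)
qed

lemma vimage_right_translation: "(\<lambda>x. x - g) -` A = (\<lambda>x. x + g) ` A" for A :: "'g set"
  by (auto simp: image_iff) (metis diff_add_cancel)

lemma vimage_right_translation': "(\<lambda>x. x + g) -` A = (\<lambda>x. x + - g) ` A" for A :: "'g set"
  using vimage_right_translation[of "- g" A] by simp

text \<open>Left and right translations commute by associativity, so pushing forward along a right
  translation preserves left invariance.\<close>

lemma left_invariant_right_translate: "left_invariant (distr m borel (\<lambda>x. x - g))"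
  unfolding left_invariant_def
proof (intro conjI allI)
  fix h
  have "distr (distr m borel (\<lambda>x. x - g)) borel ((+) h) = distr (distr m borel ((+) h)) borel (\<lambda>x. x - g)"
    by (simp add: distr_distr comp_def add_diff_eq)
  then show "distr (distr m borel (\<lambda>x. x - g)) borel ((+) h) = distr m borel (\<lambda>x. x - g)"
    using left_invariant_m by (simp add: left_invariant_def)
qed simp

lemma sigma_finite_right_translate: "sigma_finite_measure (distr m borel (\<lambda>x. x - g))"
proof
  show "\<exists>A. countable A \<and> A \<subseteq> sets (distr m borel (\<lambda>x. x - g)) \<and> \<Union>A = space (distr m borel (\<lambda>x. x - g))
    \<and> (\<forall>a\<in>A. emeasure (distr m borel (\<lambda>x. x - g)) a \<noteq> \<infinity>)"
    using compact_K Union_K compact_finite[OF compact_right_translation]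
    by (intro exI[of _ "range K"]) (auto simp: emeasure_distr vimage_right_translation less_top)
qed

text \<open>Supplies the indicator that plays the role of \<open>e\<close> in the uniqueness
  argument. An open Baire neighbourhood of 0 inside a compact set works: its right translates are
  open and nonempty, and lie in compact sets.\<close>

lemma baire_test_set:
  obtains Z where "Z \<in> sets baire" "\<And>g. emeasure m ((\<lambda>x. x + g) ` Z) \<noteq> 0"
    "\<And>g. emeasure m ((\<lambda>x. x + g) ` Z) \<noteq> \<infinity>"
proof -
  obtain U C where UC: "open U" "compact C" "(0::'g) \<in> U" "U \<subseteq> C"
    using lc unfolding locally_compact_space_def by simp metis
  obtain Z where Z: "Z \<in> sets baire" "open Z" "{0} \<subseteq> Z" "Z \<subseteq> U"
    by (rule baire_between[of "{0}" U]) (use UC in auto)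
  have "emeasure m ((\<lambda>x. x + g) ` Z) \<le> emeasure m ((\<lambda>x. x + g) ` C)" for g
    using UC Z compact_right_translation[of C g] by (intro emeasure_mono) (auto simp: sets_m)
  then have "emeasure m ((\<lambda>x. x + g) ` Z) < \<infinity>" for g
    using compact_finite[OF compact_right_translation[OF UC(2)]] le_less_trans by blast
  moreover have "emeasure m ((\<lambda>x. x + g) ` Z) \<noteq> 0" for g
    using Z by (intro open_positive open_right_translation) auto
  ultimately show thesis using Z(1) by (intro that[of Z]) (auto simp: less_top)
qed

text \<open>Uniqueness yields statements about Baire sets only; this carries a bound over to Borel
  sets. For open \<open>U\<close>, a compact subset of the image is pulled back and enclosed in a
  Baire set inside \<open>U\<close>; general \<open>A\<close> follows by outer regularity.\<close>

lemma emeasure_image_le: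
  fixes T T' :: "'g \<Rightarrow> 'g"
  assumes T: "continuous_on UNIV T" "continuous_on UNIV T'" "\<And>x. T' (T x) = x" "\<And>x. T (T' x) = x"
    and c: "c \<noteq> 0" "c \<noteq> \<infinity>"
    and le: "\<And>A. A \<in> sets baire \<Longrightarrow> emeasure m (T ` A) \<le> c * emeasure m A"
    and A: "A \<in> sets borel"
  shows "emeasure m (T ` A) \<le> c * emeasure m A"
proof -
  have T_image: "T ` X = T' -` X" for X using T(3,4) by (auto simp: image_iff) metis
  have [measurable]: "T' \<in> measurable borel borel" using T(2) by (rule borel_measurable_continuous_onI)
  have T_sets: "T ` X \<in> sets borel" if "X \<in> sets borel" for X
    using measurable_sets[OF _ that, of T' borel] by (simp add: T_image)
  have op: "emeasure m (T ` U) \<le> c * emeasure m U" if U: "open U" for U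
  proof -
    have "open (T ` U)" unfolding T_image using U T(2) by (rule open_vimage)
    then have "emeasure m (T ` U) = (SUP C\<in>{C. compact C \<and> C \<subseteq> T ` U}. emeasure m C)" by (rule inner)
    also have "\<dots> \<le> c * emeasure m U"
    proof (rule SUP_least)
      fix C assume "C \<in> {C. compact C \<and> C \<subseteq> T ` U}"
      then have C: "compact C" "C \<subseteq> T ` U" by auto
      have "compact (T' ` C)" using C(1) T(2) by (intro compact_continuous_image continuous_on_subset[OF T(2)]) auto
      moreover have "T' ` C \<subseteq> U" using C(2) T(3) by auto
      ultimately obtain Z where Z: "Z \<in> sets baire" "open Z" "T' ` C \<subseteq> Z" "Z \<subseteq> U"
        using baire_between[OF _ U] by metis
      have "C = T ` T' ` C" using T(4) by (simp add: image_image)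
      then have "C \<subseteq> T ` Z" using Z(3) by blast
      then have "emeasure m C \<le> emeasure m (T ` Z)"
        using T_sets[of Z] Z(2) by (intro emeasure_mono) (auto simp: sets_m)
      also have "\<dots> \<le> c * emeasure m Z" by (rule le[OF Z(1)])
      also have "\<dots> \<le> c * emeasure m U"
        using Z U by (intro mult_left_mono emeasure_mono) (auto simp: sets_m)
      finally show "emeasure m C \<le> c * emeasure m U" .
    qed
    finally show ?thesis .
  qed
  have "emeasure m (T ` A) \<le> c * emeasure m U" if "open U" "A \<subseteq> U" for U
  proof -
    have "emeasure m (T ` A) \<le> emeasure m (T ` U)"
      using that T_sets[of U] by (intro emeasure_mono) (auto simp: sets_m)
    then show ?thesis using op[OF that(1)] by simp
  qed
  \<comment> \<open>Dividing by \<open>c\<close> isolates \<open>emeasure m U\<close>, so that the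
    infimum over open supersets can be taken; as \<open>c\<close> is nonzero and finite, multiplying
    back is harmless.\<close>
  then have "emeasure m (T ` A) / c \<le> emeasure m U" if "open U" "A \<subseteq> U" for U
    using that c by (intro divide_le_posI_ennreal) (auto simp: zero_less_iff_neq_zero)
  then have "emeasure m (T ` A) / c \<le> emeasure m A"
    unfolding outer[OF A] by (intro INF_greatest) auto
  then have "emeasure m (T ` A) / c * c \<le> emeasure m A * c" by (rule mult_right_mono) simp
  also have "emeasure m (T ` A) / c * c = emeasure m (T ` A) * c / c"
    by (simp add: ennreal_divide_times ennreal_times_divide)
  also have "\<dots> = emeasure m (T ` A)" using c by (intro mult_divide_eq_ennreal) auto
  finally show ?thesis by (simp add: mult.commute)
qed

lemma emeasure_right_translate:
  "A \<in> sets borel \<Longrightarrow> emeasure (distr m borel (\<lambda>x. x - g)) A = emeasure m ((\<lambda>x. x + g) ` A)"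
  by (subst emeasure_distr) (auto simp: vimage_right_translation)

lemma baire_right_translate:
  assumes "A \<in> sets baire"
  shows "(\<lambda>x. x + g) ` A \<in> sets (baire :: 'g measure)"
proof -
  have "(\<lambda>x. x - g) \<in> measurable baire (baire :: 'g measure)"
    by (intro measurable_continuous_baire continuous_intros)
  from measurable_sets[OF this assms] show ?thesis by (simp add: vimage_right_translation)
qed

text \<open>A right translate of \<open>m\<close> is left invariant, hence proportional to
  \<open>m\<close> on Baire sets by uniqueness. Regularity extends this to Borel sets as an
  inequality, which is used for both \<open>g\<close> and \<open>- g\<close> to obtain
  equality.\<close>

lemma ex_modular_function:
  "\<exists>\<Delta>. \<forall>g. \<forall>A\<in>sets borel. emeasure m ((\<lambda>x. x + g) ` A) = \<Delta> g * emeasure m A"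
proof -
  obtain Z where Z: "Z \<in> sets baire" "\<And>g. emeasure m ((\<lambda>x. x + g) ` Z) \<noteq> 0"
    "\<And>g. emeasure m ((\<lambda>x. x + g) ` Z) \<noteq> \<infinity>"
    by (rule baire_test_set) blast
  have Zb: "Z \<in> sets borel" using Z(1) sets_baire_subset_borel by blast
  have Z0: "emeasure m Z \<noteq> 0" "emeasure m Z \<noteq> \<infinity>" using Z(2,3)[of 0] by auto
  \<comment> \<open>The factor is read off from the test set; uniqueness shows that every other
    Baire set scales in the same way.\<close>
  define \<Delta> where "\<Delta> g = emeasure m ((\<lambda>x. x + g) ` Z) / emeasure m Z" for g
  have \<Delta>: "\<Delta> g \<noteq> 0" "\<Delta> g \<noteq> \<infinity>" for g
    using Z Z0 by (auto simp: \<Delta>_def ennreal_divide_eq_top_iff)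
  have baire_eq: "emeasure m ((\<lambda>x. x + g) ` A) = \<Delta> g * emeasure m A" if A: "A \<in> sets baire" for g A
  proof -
    have Ab: "A \<in> sets borel" using A sets_baire_subset_borel by blast
    define \<nu> where "\<nu> = distr m borel (\<lambda>x. x - g)"
    have [measurable_cong]: "sets \<nu> = sets borel" by (simp add: \<nu>_def)
    \<comment> \<open>These are the weights that \<open>left_invariant_unique\<close> requires to be
      nonzero and finite; they are measures of right translates of \<open>Z\<close>.\<close>
    have w: "(\<integral>\<^sup>+y. indicator Z (y + x) \<partial>\<nu>) = emeasure m ((\<lambda>y. y + (- x + g)) ` Z)" for x
    proof -
      have "(\<integral>\<^sup>+y. indicator Z (y + x) \<partial>\<nu>) = (\<integral>\<^sup>+y. indicator ((\<lambda>y. y + - x) ` Z) y \<partial>\<nu>)"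
        unfolding vimage_right_translation'[symmetric] by (simp add: indicator_vimage comp_def)
      also have "\<dots> = emeasure \<nu> ((\<lambda>y. y + - x) ` Z)"
        using baire_right_translate[OF Z(1), of "- x"] sets_baire_subset_borel
        by (intro nn_integral_indicator) (auto simp: \<nu>_def)
      also have "\<dots> = emeasure m ((\<lambda>y. y + g) ` (\<lambda>y. y + - x) ` Z)"
        unfolding \<nu>_def using baire_right_translate[OF Z(1), of "- x"] sets_baire_subset_borel
        by (intro emeasure_right_translate) auto
      finally show ?thesis by (simp only: image_image add.assoc)
    qed
    have "(\<integral>\<^sup>+x. indicator Z x \<partial>\<nu>) * (\<integral>\<^sup>+x. indicator A x \<partial>m)
        = (\<integral>\<^sup>+x. indicator Z x \<partial>m) * (\<integral>\<^sup>+x. indicator A x \<partial>\<nu>)"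
    proof (rule left_invariant_unique)
      show "left_invariant \<nu>" "sigma_finite_measure \<nu>"
        unfolding \<nu>_def by (rule left_invariant_right_translate sigma_finite_right_translate)+
    qed (use left_invariant_m sigma_finite_measure_axioms A Z w in auto)
    then have "emeasure m ((\<lambda>x. x + g) ` Z) * emeasure m A = emeasure m Z * emeasure m ((\<lambda>x. x + g) ` A)"
      using Ab Zb by (simp add: sets_m \<nu>_def emeasure_right_translate)
    then have "emeasure m ((\<lambda>x. x + g) ` A) * emeasure m Z / emeasure m Z
        = emeasure m ((\<lambda>x. x + g) ` Z) * emeasure m A / emeasure m Z"
      by (simp add: mult.commute)
    then show ?thesis
      using Z0 by (simp add: \<Delta>_def mult_divide_eq_ennreal ennreal_divide_times ennreal_times_divide)
  qed
  have le: "emeasure m ((\<lambda>x. x + g) ` A) \<le> \<Delta> g * emeasure m A" if "A \<in> sets borel" for g A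
    by (rule emeasure_image_le[where T'="\<lambda>x. x - g"])
      (use \<Delta> that baire_eq in \<open>auto intro!: continuous_intros\<close>)
  \<comment> \<open>This turns the upper bound for the translation by \<open>- g\<close> into the
    lower bound for the translation by \<open>g\<close>.\<close>
  have inv: "\<Delta> g * \<Delta> (- g) = 1" for g
  proof -
    have "emeasure m ((\<lambda>x. x + g) ` (\<lambda>x. x + - g) ` Z) = \<Delta> g * (\<Delta> (- g) * emeasure m Z)"
      using baire_eq baire_right_translate Z(1) by metis
    then have "emeasure m Z * 1 = emeasure m Z * (\<Delta> g * \<Delta> (- g))"
      by (simp add: image_image ac_simps)
    then show ?thesis unfolding ennreal_mult_cancel_left using Z0 by auto
  qed
  show ?thesis
  proof (intro exI[of _ \<Delta>] allI ballI antisym)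
    fix g and A :: "'g set" assume A: "A \<in> sets borel"
    show "emeasure m ((\<lambda>x. x + g) ` A) \<le> \<Delta> g * emeasure m A" using le[OF A] .
    have Ag: "(\<lambda>x. x + g) ` A \<in> sets borel"
      using measurable_sets[OF borel_measurable_right_translation_diff A, of g]
      by (simp add: vimage_right_translation)
    have "\<Delta> g * emeasure m A = \<Delta> g * emeasure m ((\<lambda>x. x + - g) ` (\<lambda>x. x + g) ` A)"
      by (simp add: image_image)
    also have "\<dots> \<le> \<Delta> g * (\<Delta> (- g) * emeasure m ((\<lambda>x. x + g) ` A))"
      by (intro mult_left_mono le[OF Ag]) simp
    also have "\<dots> = emeasure m ((\<lambda>x. x + g) ` A)"
      using inv[of g] by (simp add: mult.assoc[symmetric])
    finally show "\<Delta> g * emeasure m A \<le> emeasure m ((\<lambda>x. x + g) ` A)" .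
  qed
qed

text \<open>Under right invariance the inner integral of the product identity is the constant
  \<open>emeasure m Z\<close>. The identity for the indicators of \<open>Z\<close> and
  \<open>X\<close> then equates the measures of \<open>X\<close> and of its reflection, after
  cancelling this constant.\<close>

lemma uminus_invariant:
  assumes right: "\<And>g A. A \<in> sets borel \<Longrightarrow> emeasure m ((\<lambda>x. x + g) ` A) = emeasure m A"
    and A: "A \<in> sets borel"
  shows "emeasure m (uminus ` A) = emeasure m A"
proof -
  obtain Z where Z: "Z \<in> sets baire" "\<And>g. emeasure m ((\<lambda>x. x + g) ` Z) \<noteq> 0"
    "\<And>g. emeasure m ((\<lambda>x. x + g) ` Z) \<noteq> \<infinity>"
    by (rule baire_test_set) blast
  have Zb: "Z \<in> sets m" using Z(1) sets_baire_subset_borel sets_m by blast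
  have Z0: "emeasure m Z \<noteq> 0" "emeasure m Z \<noteq> \<infinity>" using Z(2,3)[of 0] by auto
  have vim: "uminus -` X = uminus ` X" for X :: "'g set"
    by (auto simp: image_iff) (metis minus_minus)
  have sets_uminus: "uminus ` X \<in> sets borel" if "X \<in> sets borel" for X :: "'g set"
    using measurable_sets[OF borel_measurable_group_uminus that] by (simp add: vim)
  have eq: "emeasure m (uminus ` X) = emeasure m X" if X: "X \<in> sets baire" for X
  proof -
    have Xb: "X \<in> sets borel" using X sets_baire_subset_borel by blast
    have w: "(\<integral>\<^sup>+y. indicator Z (y + x) \<partial>m) = emeasure m Z" for x
    proof -
      have "(\<integral>\<^sup>+y. indicator Z (y + x) \<partial>m) = (\<integral>\<^sup>+y. indicator ((\<lambda>y. y + - x) ` Z) y \<partial>m)"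
        unfolding vimage_right_translation'[symmetric] by (simp add: indicator_vimage comp_def)
      also have "\<dots> = emeasure m ((\<lambda>y. y + - x) ` Z)"
        using baire_right_translate[OF Z(1), of "- x"] sets_baire_subset_borel
        by (intro nn_integral_indicator) (auto simp: sets_m)
      finally show ?thesis using right[of Z "- x"] Zb sets_m by simp
    qed
    have "emeasure m Z * emeasure m X = (\<integral>\<^sup>+x. indicator X (- x) * emeasure m Z \<partial>m)"
      using nn_integral_product_swap[OF left_invariant_m sigma_finite_measure_axioms
          left_invariant_m sigma_finite_measure_axioms, of "indicator Z" "indicator X"] X Z(1) Zb Xb
      by (simp add: w sets_m)
    also have "\<dots> = (\<integral>\<^sup>+x. emeasure m Z * indicator (uminus ` X) x \<partial>m)"
      unfolding vim[symmetric] by (simp add: indicator_vimage comp_def mult.commute)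
    also have "\<dots> = emeasure m Z * emeasure m (uminus ` X)"
      using sets_uminus[OF Xb] by (intro nn_integral_cmult_indicator) (simp add: sets_m)
    finally show ?thesis using Z0 by (metis ennreal_mult_cancel_left infinity_ennreal_def)
  qed
  have le: "emeasure m (uminus ` X) \<le> emeasure m X" if "X \<in> sets borel" for X
    using emeasure_image_le[where T=uminus and T'=uminus and c=1 and A=X] that eq
      continuous_on_minus[OF continuous_on_id, of "UNIV :: 'g set"]
    by simp
  show ?thesis
    using le[OF A] le[OF sets_uminus[OF A]] by (simp add: image_image)
qed

end

section \<open>Word powers and unimodularity\<close>

lemma word_power_0 [simp]: "word_power S 0 = {0}"
  by (auto simp: word_power_def)

lemma word_power_Suc: "word_power S (Suc n) = (\<lambda>(x, y). x + y) ` (S \<times> word_power S n)"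
proof (intro equalityI subsetI)
  fix x assume "x \<in> word_power S (Suc n)"
  then obtain ss where ss: "x = sum_list ss" "length ss = Suc n" "set ss \<subseteq> S" by (auto simp: word_power_def)
  then obtain s ss' where "ss = s # ss'" by (cases ss) auto
  with ss have "x = s + sum_list ss'" "s \<in> S" "sum_list ss' \<in> word_power S n"
    by (auto simp: word_power_def)
  then show "x \<in> (\<lambda>(x, y). x + y) ` (S \<times> word_power S n)" by auto
next
  fix x assume "x \<in> (\<lambda>(x, y). x + y) ` (S \<times> word_power S n)"
  then obtain s ss where "x = s + sum_list ss" "s \<in> S" "length ss = n" "set ss \<subseteq> S"
    by (auto simp: word_power_def)
  then show "x \<in> word_power S (Suc n)"
    unfolding word_power_def by (intro CollectI exI[of _ "s # ss"]) auto
qed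

lemma word_power_1 [simp]: "word_power S (Suc 0) = S"
  by (force simp: word_power_Suc)

lemma word_power_add:
  assumes "x \<in> word_power S a" "y \<in> word_power S b"
  shows "x + y \<in> word_power S (a + b)"
proof -
  obtain xs ys where "x = sum_list xs" "length xs = a" "set xs \<subseteq> S" "y = sum_list ys" "length ys = b" "set ys \<subseteq> S"
    using assms by (auto simp: word_power_def)
  then show ?thesis unfolding word_power_def by (intro CollectI exI[of _ "xs @ ys"]) auto
qed

lemma word_power_mono:
  assumes "0 \<in> S" "a \<le> b"
  shows "word_power S a \<subseteq> word_power S b"
proof
  fix x assume x: "x \<in> word_power S a"
  have "sum_list (replicate n 0) = (0::'a)" for n by (induction n) auto
  moreover have "sum_list (replicate (b - a) 0) \<in> word_power S (b - a)"
    unfolding word_power_def using assms(1) by (intro CollectI exI[of _ "replicate (b - a) 0"]) auto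
  ultimately have "x + 0 \<in> word_power S (a + (b - a))" using x
    by (metis word_power_add)
  then show "x \<in> word_power S b" using assms(2) by simp
qed

lemma word_power_uminus:
  fixes S :: "'a::group_add set"
  assumes S: "uminus ` S = S" and x: "x \<in> word_power S n"
  shows "- x \<in> word_power S n"
  using x
proof (induction n arbitrary: x)
  case (Suc n)
  then obtain s y where sy: "x = s + y" "s \<in> S" "y \<in> word_power S n" by (auto simp: word_power_Suc)
  have "- y + - s \<in> word_power S (n + Suc 0)"
    using sy Suc.IH S by (intro word_power_add) auto
  then show ?case by (simp add: sy minus_add)
qed simp

lemma compact_word_power:
  fixes S :: "'a::topological_monoid_add set"
  assumes "compact S"
  shows "compact (word_power S n)"
proof (induction n)
  case (Suc n)
  then show ?case unfolding word_power_Suc split_def using assms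
    by (intro compact_continuous_image compact_Times continuous_intros)
qed simp

section \<open>Elementary inequalities: squared differences, averages, polynomial against
  exponential growth\<close>

lemma dist_square_triangle:
  fixes a b c :: complex
  shows "ennreal ((cmod (a - c))\<^sup>2) \<le> 2 * ennreal ((cmod (a - b))\<^sup>2) + 2 * ennreal ((cmod (b - c))\<^sup>2)"
proof -
  have "(cmod (a - c))\<^sup>2 \<le> (cmod (a - b) + cmod (b - c))\<^sup>2"
    using norm_triangle_ineq[of "a - b" "b - c"] by (intro power_mono) auto
  also have "\<dots> \<le> 2 * (cmod (a - b))\<^sup>2 + 2 * (cmod (b - c))\<^sup>2"
    using zero_le_power2[of "cmod (a - b) - cmod (b - c)"] by (simp add: power2_eq_square algebra_simps)
  finally show ?thesis by (simp flip: ennreal_mult ennreal_plus ennreal_numeral)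
qed

text \<open>Cauchy-Schwarz for the telescoping sum; the factor \<open>k\<close> is the number of
  steps.\<close>

lemma telescoping_square:
  fixes g :: "nat \<Rightarrow> complex"
  shows "ennreal ((cmod (g k - g 0))\<^sup>2) \<le> of_nat k * (\<Sum>i<k. ennreal ((cmod (g (Suc i) - g i))\<^sup>2))"
proof -
  have "g k - g 0 = (\<Sum>i<k. g (Suc i) - g i)" by (rule sum_lessThan_telescope[symmetric])
  then have "cmod (g k - g 0) \<le> (\<Sum>i<k. cmod (g (Suc i) - g i))" by (simp add: norm_sum)
  then have "(cmod (g k - g 0))\<^sup>2 \<le> (\<Sum>i<k. cmod (g (Suc i) - g i))\<^sup>2" by (intro power_mono) auto
  also have "\<dots> \<le> real k * (\<Sum>i<k. (cmod (g (Suc i) - g i))\<^sup>2)"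
    using sum_squared_le_sum_of_squares[of "\<lambda>i. cmod (g (Suc i) - g i)" "{..<k}"]
    by (simp add: mult.commute)
  finally have "ennreal ((cmod (g k - g 0))\<^sup>2) \<le> ennreal (real k * (\<Sum>i<k. (cmod (g (Suc i) - g i))\<^sup>2))"
    by (rule ennreal_leI)
  then show ?thesis by (simp add: ennreal_mult sum_nonneg ennreal_of_nat_eq_real_of_nat)
qed

text \<open>The difference of \<open>a\<close> and the average is the average of
  \<open>a - g\<close>. Cauchy-Schwarz against the indicator of \<open>B\<close> costs one factor
  \<open>measure M B\<close>, which leaves one in the denominator.\<close>

lemma square_average_le:
  fixes g :: "'a \<Rightarrow> complex"
  assumes g: "set_integrable M B g" and B: "B \<in> sets M" "0 < measure M B" "emeasure M B < \<infinity>"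
  shows "ennreal ((cmod (a - set_average M B g))\<^sup>2)
    \<le> (\<integral>\<^sup>+y\<in>B. ennreal ((cmod (a - g y))\<^sup>2) \<partial>M) / ennreal (measure M B)"
proof -
  let ?b = "measure M B"
  have const: "set_integrable M B (\<lambda>_. a)" using B by (simp add: set_integrable_def)
  have diff: "set_integrable M B (\<lambda>y. a - g y)" using const g by (rule set_integral_diff)
  have "(\<lambda>y. indicator B y *\<^sub>R (a - g y)) \<in> borel_measurable M"
    using diff by (simp add: set_integrable_def)
  then have h: "(\<lambda>y. ennreal (norm (indicator B y *\<^sub>R (a - g y)))) \<in> borel_measurable M"
    by (rule measurable_compose[OF measurable_compose[OF _ borel_measurable_norm] measurable_ennreal])
  have "(LINT y:B|M. a - g y) = ?b *\<^sub>R a - (LINT y:B|M. g y)"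
    using const g B by (simp add: set_integral_diff set_integral_const)
  then have avg: "a - set_average M B g = (LINT y:B|M. a - g y) /\<^sub>R ?b"
    using B by (simp add: set_average_def scaleR_diff_right)
  let ?h = "\<lambda>y. ennreal (norm (indicator B y *\<^sub>R (a - g y)))"
  have "ennreal (norm (LINT y:B|M. a - g y)) \<le> (\<integral>\<^sup>+y. ?h y \<partial>M)"
    unfolding set_lebesgue_integral_def using diff by (intro integral_norm_bound_ennreal) (simp add: set_integrable_def)
  then have "(ennreal (norm (LINT y:B|M. a - g y)))\<^sup>2 \<le> (\<integral>\<^sup>+y. ?h y \<partial>M)\<^sup>2"
    by (intro power_mono) auto
  also have "\<dots> = (\<integral>\<^sup>+y. ?h y * indicator B y \<partial>M)\<^sup>2"
    by (intro arg_cong[where f="\<lambda>x. x\<^sup>2"] nn_integral_cong) (simp add: indicator_def)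
  also have "\<dots> \<le> (\<integral>\<^sup>+y. (?h y)\<^sup>2 \<partial>M) * (\<integral>\<^sup>+y. (indicator B y)\<^sup>2 \<partial>M)"
    using h B(1) by (intro Cauchy_Schwarz_nn_integral) (rule borel_measurable_indicator | assumption)+
  also have "(\<integral>\<^sup>+y. (indicator B y)\<^sup>2 \<partial>M) = ennreal ?b"
  proof -
    have "(\<integral>\<^sup>+y. (indicator B y)\<^sup>2 \<partial>M) = (\<integral>\<^sup>+y. indicator B y \<partial>M)"
      by (intro nn_integral_cong) (simp add: indicator_def)
    then show ?thesis using B by (simp add: emeasure_eq_ennreal_measure)
  qed
  also have "(\<integral>\<^sup>+y. (?h y)\<^sup>2 \<partial>M) = (\<integral>\<^sup>+y\<in>B. ennreal ((cmod (a - g y))\<^sup>2) \<partial>M)"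
    by (intro nn_integral_cong) (auto simp: indicator_def ennreal_power)
  finally have *: "ennreal ((norm (LINT y:B|M. a - g y))\<^sup>2)
      \<le> (\<integral>\<^sup>+y\<in>B. ennreal ((cmod (a - g y))\<^sup>2) \<partial>M) * ennreal ?b"
    by (simp add: ennreal_power)
  have "ennreal ((cmod (a - set_average M B g))\<^sup>2) = ennreal ((norm (LINT y:B|M. a - g y))\<^sup>2) / ennreal (?b\<^sup>2)"
    using B by (simp add: avg divide_ennreal power_divide power_mult_distrib field_simps)
  also have "\<dots> \<le> (\<integral>\<^sup>+y\<in>B. ennreal ((cmod (a - g y))\<^sup>2) \<partial>M) * ennreal ?b / ennreal (?b\<^sup>2)"
    using * by (rule divide_right_mono_ennreal)
  also have "\<dots> = (\<integral>\<^sup>+y\<in>B. ennreal ((cmod (a - g y))\<^sup>2) \<partial>M) * (ennreal ?b / ennreal (?b\<^sup>2))"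
    by (rule ennreal_times_divide[symmetric])
  also have "ennreal ?b / ennreal (?b\<^sup>2) = inverse (ennreal ?b)"
    using B by (simp add: divide_ennreal inverse_ennreal power2_eq_square field_simps)
  finally show ?thesis by (simp add: divide_ennreal_def)
qed

text \<open>With s = r^(-1/d) < 1 the quotient is the d-th power of (kj + 1) s^j, where a linear
  factor meets a geometric one.\<close>

lemma powr_over_exponential_tendsto_0:
  fixes d k r :: real
  assumes "d > 0" "r > 1" "k \<ge> 0"
  shows "(\<lambda>j. (k * real j + 1) powr d / r ^ j) \<longlonglongrightarrow> 0"
proof -
  define s where "s = r powr (- 1 / d)"
  have s: "0 < s" "s < 1" using assms by (auto simp: s_def powr_less_one)
  have "(\<lambda>j. k * (real j * s ^ j) + s ^ j) \<longlonglongrightarrow> k * 0 + 0"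
    using s by (intro tendsto_intros powser_times_n_limit_0 LIMSEQ_power_zero) auto
  then have "(\<lambda>j. (k * real j + 1) * s ^ j) \<longlonglongrightarrow> 0" by (simp add: algebra_simps)
  then have "(\<lambda>j. ((k * real j + 1) * s ^ j) powr d) \<longlonglongrightarrow> 0"
    using assms s by (intro tendsto_zero_powrI[where b=d]) auto
  moreover have "((k * real j + 1) * s ^ j) powr d = (k * real j + 1) powr d / r ^ j" for j
  proof -
    have "(s ^ j) powr d = r powr (- real j)"
      using assms s by (simp add: s_def powr_powr powr_power)
    also have "\<dots> = 1 / r ^ j" using assms by (simp add: powr_minus powr_realpow inverse_eq_divide)
    finally show ?thesis using assms s by (simp add: powr_mult)
  qed
  ultimately show ?thesis by simp
qed

section \<open>Compactly generated groups: balls as translated word powers, unimodularity from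
  growth\<close>

locale compactly_generated_haar =
  fixes S :: "'g::{topological_group_add,t2_space} set" and m :: "'g measure"
  assumes lc': "locally_compact_space (euclidean :: 'g topology)"
    and generating: "compact_symmetric_generating_set S"
    and haar': "left_haar_measure m"
begin

lemma compact_S: "compact S" and uminus_S: "uminus ` S = S" and zero_S: "0 \<in> S"
  and Union_S: "(\<Union>n\<in>{1..}. word_power S n) = UNIV"
  using generating by (auto simp: compact_symmetric_generating_set_def)

sublocale sigma_compact_haar "word_power S" m
proof
  show "(\<Union>n. word_power S n) = UNIV" using Union_S by blast
qed (use lc' haar' compact_word_power compact_S in auto)

text \<open>Word lengths are integers, so a radius acts through its integer part;
  \<open>0 \<in> S\<close> makes the word powers increase, so that minimal length at most n amounts
  to membership in the n-th power.\<close>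

lemma word_ball_eq:
  assumes "0 \<le> R"
  shows "word_ball S x R = (+) x ` word_power S (nat \<lfloor>R\<rfloor>)"
proof -
  have "real (word_length S z) \<le> R \<longleftrightarrow> z \<in> word_power S (nat \<lfloor>R\<rfloor>)" for z
  proof
    obtain n where "z \<in> word_power S n" using Union_S by blast
    then have "z \<in> word_power S (word_length S z)" unfolding word_length_def by (rule LeastI)
    moreover assume "real (word_length S z) \<le> R"
    then have "word_length S z \<le> nat \<lfloor>R\<rfloor>" by linarith
    ultimately show "z \<in> word_power S (nat \<lfloor>R\<rfloor>)" using word_power_mono[OF zero_S] by blast
  next
    assume "z \<in> word_power S (nat \<lfloor>R\<rfloor>)"
    then have "word_length S z \<le> nat \<lfloor>R\<rfloor>" unfolding word_length_def by (rule Least_le)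
    then show "real (word_length S z) \<le> R" using assms by linarith
  qed
  then have "word_ball S x R = {y. - x + y \<in> word_power S (nat \<lfloor>R\<rfloor>)}" by (simp add: word_ball_def)
  also have "\<dots> = (+) x ` word_power S (nat \<lfloor>R\<rfloor>)"
  proof (intro equalityI subsetI)
    fix y assume "y \<in> {y. - x + y \<in> word_power S (nat \<lfloor>R\<rfloor>)}"
    moreover have "y = x + (- x + y)" by (simp add: add.assoc[symmetric])
    ultimately show "y \<in> (+) x ` word_power S (nat \<lfloor>R\<rfloor>)" by blast
  qed (auto simp: add.assoc[symmetric])
  finally show ?thesis .
qed

text \<open>A value \<open>\<Delta>(g) > 1\<close> of the modular function would make \<open>m (S\<^sup>n g\<^sup>j)\<close> grow exponentially in \<open>j\<close>.\<close>

lemma right_invariant: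
  assumes S1: "emeasure m S = 1" and growth: "polynomial_growth S m" and A: "A \<in> sets borel"
  shows "emeasure m ((\<lambda>x. x + g) ` A) = emeasure m A"
proof -
  obtain \<Delta> where \<Delta>: "\<And>g A. A \<in> sets borel \<Longrightarrow> emeasure m ((\<lambda>x. x + g) ` A) = \<Delta> g * emeasure m A"
    using ex_modular_function by metis
  have S_eq: "\<Delta> g = emeasure m ((\<lambda>x. x + g) ` S)" for g using \<Delta>[of S g] S1 compact_S by simp
  have add: "\<Delta> (g + h) = \<Delta> h * \<Delta> g" for g h
    using \<Delta>[of "(\<lambda>x. x + g) ` S" h] compact_right_translation[OF compact_S, of g]
    by (simp add: S_eq image_image add.assoc)
  have zero: "\<Delta> 0 = 1" by (simp add: S_eq S1)
  have fin: "\<Delta> g < \<infinity>" for g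
    unfolding S_eq using compact_S by (intro compact_finite compact_right_translation)
  obtain C d where C: "C > 0" "d > 0" "\<And>n. n > 0 \<Longrightarrow> emeasure m (word_power S n) \<le> ennreal (C * real n powr d)"
    using growth by (auto simp: polynomial_growth_def)
  have le1: "\<Delta> g \<le> 1" for g
  proof (rule ccontr)
    assume not: "\<not> \<Delta> g \<le> 1"
    define r where "r = enn2real (\<Delta> g)"
    have r: "\<Delta> g = ennreal r" unfolding r_def using fin[of g] by simp
    have r1: "r > 1" using not by (simp add: r not_le flip: ennreal_1)
    obtain k where k: "g \<in> word_power S k" using Union_S by blast
    \<comment> \<open>A word of length \<open>k\<close> for \<open>g\<close> gives one of length
      \<open>k * j\<close> for the j-fold multiple of \<open>g\<close>, at which \<Delta> takes the
      value r^j.\<close>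
    have pow: "\<exists>h \<in> word_power S (k * j). \<Delta> h = ennreal (r ^ j)" for j
    proof (induction j)
      case 0
      then show ?case by (simp add: zero)
    next
      case (Suc j)
      then obtain h where h: "h \<in> word_power S (k * j)" "\<Delta> h = ennreal (r ^ j)" by blast
      then have "g + h \<in> word_power S (k * Suc j)" using word_power_add[OF k h(1)] by simp
      moreover have "\<Delta> (g + h) = ennreal (r ^ Suc j)"
        using r1 by (simp add: add h r ennreal_mult mult.commute)
      ultimately show ?case by blast
    qed
    have bound: "r ^ j \<le> C * real (Suc (k * j)) powr d" for j
    proof -
      obtain h where h: "h \<in> word_power S (k * j)" "\<Delta> h = ennreal (r ^ j)" using pow by blast
      \<comment> \<open>The translate of \<open>S\<close> by \<open>h\<close> has measure exactly
        \<open>\<Delta> h\<close> because m(S) = 1; the factor from \<open>S\<close> adds one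
        letter, hence \<open>Suc (k * j)\<close>.\<close>
      have "(\<lambda>x. x + h) ` S \<subseteq> word_power S (Suc (k * j))"
        using word_power_add[of _ S "Suc 0" h "k * j"] h(1) by auto
      then have "\<Delta> h \<le> emeasure m (word_power S (Suc (k * j)))"
        unfolding S_eq using compact_word_power[OF compact_S] by (intro emeasure_mono) (auto simp: sets_m)
      also have "\<dots> \<le> ennreal (C * real (Suc (k * j)) powr d)" by (rule C(3)) simp
      finally show ?thesis using C by (simp add: h(2))
    qed
    have "(\<lambda>j. C * ((real k * real j + 1) powr d / r ^ j)) \<longlonglongrightarrow> C * 0"
      using r1 C(2) by (intro tendsto_intros powr_over_exponential_tendsto_0) auto
    then have "(\<lambda>j. C * real (Suc (k * j)) powr d / r ^ j) \<longlonglongrightarrow> 0"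
      by (simp add: add.commute)
    then have "eventually (\<lambda>j. C * real (Suc (k * j)) powr d / r ^ j < 1) sequentially"
      by (rule order_tendstoD) simp
    then obtain j where "C * real (Suc (k * j)) powr d / r ^ j < 1" by (auto simp: eventually_sequentially)
    then show False using bound[of j] r1 by (simp add: field_simps)
  qed
  \<comment> \<open>Both factors are at most 1 and their product is 1, so both equal 1.\<close>
  have "\<Delta> g * \<Delta> (- g) = 1" using add[of "- g" g] zero by simp
  then have "1 \<le> \<Delta> g * 1" using le1[of "- g"] by (metis mult_left_mono zero_le)
  then have "\<Delta> g = 1" using le1[of g] by simp
  then show ?thesis using \<Delta>[OF A] by simp
qed

end

section \<open>The Poincare inequality\<close>

abbreviation (input) sqdist :: "complex \<Rightarrow> complex \<Rightarrow> ennreal" where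
  "sqdist a b \<equiv> ennreal ((cmod (a - b))\<^sup>2)"

lemma gradient2_square:
  "(gradient2 \<mu> f x)\<^sup>2 = (\<integral>\<^sup>+s. sqdist (f (x + s)) (f x) \<partial>\<mu>)"
proof -
  have "(ennreal_sqrt a)\<^sup>2 = a" for a
    by (cases a) (auto simp: ennreal_sqrt_def power2_eq_square simp flip: ennreal_mult)
  then show ?thesis by (simp add: gradient2_def)
qed

context compactly_generated_haar begin

lemma word_power_sets [simp]: "word_power S n \<in> sets borel"
  using compact_word_power[OF compact_S] by simp

lemma translate_sets: "A \<in> sets borel \<Longrightarrow> (+) x ` A \<in> sets borel" for A :: "'g set"
proof -
  assume A: "A \<in> sets borel"
  have "(+) x ` A = (+) (- x) -` A"
    by (auto simp: image_iff) (metis add.assoc add.left_neutral right_minus)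
  then show ?thesis using measurable_sets[OF borel_measurable_left_translation A, of "- x"] by simp
qed

lemma mem_translate_iff: "y \<in> (+) x ` A \<longleftrightarrow> - x + y \<in> A" for A :: "'g set"
  by (auto simp: image_iff add.assoc[symmetric]) (metis add.assoc add.left_neutral right_minus)

lemma nn_integral_left:
  "f \<in> borel_measurable borel \<Longrightarrow> (\<integral>\<^sup>+x. f (g + x) \<partial>m) = (\<integral>\<^sup>+x. f x \<partial>m)"
  by (rule nn_integral_left_translation[OF left_invariant_m])

end

section \<open>Displacement estimates under two-sided invariance\<close>

locale unimodular_compactly_generated_haar = compactly_generated_haar +
  assumes right: "\<And>g A. A \<in> sets borel \<Longrightarrow> emeasure m ((\<lambda>x. x + g) ` A) = emeasure m A"
begin

lemma nn_integral_right:
  assumes [measurable]: "f \<in> borel_measurable borel"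
  shows "(\<integral>\<^sup>+x. f (x + g) \<partial>m) = (\<integral>\<^sup>+x. f x \<partial>m)"
proof -
  have "distr m borel (\<lambda>x. x + g) = m"
  proof (rule measure_eqI)
    fix A assume "A \<in> sets (distr m borel (\<lambda>x. x + g))"
    then have A: "A \<in> sets borel" by simp
    then show "emeasure (distr m borel (\<lambda>x. x + g)) A = emeasure m A"
      using right[OF A, of "- g"] by (subst emeasure_distr) (auto simp: vimage_right_translation')
  qed (simp add: sets_m)
  then have "(\<integral>\<^sup>+x. f x \<partial>m) = (\<integral>\<^sup>+x. f x \<partial>distr m borel (\<lambda>x. x + g))" by simp
  also have "\<dots> = (\<integral>\<^sup>+x. f (x + g) \<partial>m)" by (rule nn_integral_distr) auto
  finally show ?thesis ..
qed

lemma nn_integral_uminus: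
  assumes [measurable]: "f \<in> borel_measurable borel"
  shows "(\<integral>\<^sup>+x. f (- x) \<partial>m) = (\<integral>\<^sup>+x. f x \<partial>m)"
proof -
  have "distr m borel uminus = m"
  proof (rule measure_eqI)
    fix A assume "A \<in> sets (distr m borel (uminus :: 'a \<Rightarrow> 'a))"
    then have A: "A \<in> sets borel" by simp
    have "uminus -` A = uminus ` A" by (auto simp: image_iff) (metis minus_minus)
    then show "emeasure (distr m borel uminus) A = emeasure m A"
      using uminus_invariant[OF right A] A by (subst emeasure_distr) auto
  qed (simp add: sets_m)
  then have "(\<integral>\<^sup>+x. f x \<partial>m) = (\<integral>\<^sup>+x. f x \<partial>distr m borel uminus)" by simp
  also have "\<dots> = (\<integral>\<^sup>+x. f (- x) \<partial>m)" by (rule nn_integral_distr) auto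
  finally show ?thesis ..
qed

text \<open>Together with \<open>measurable_baire_add\<close>, this makes \<open>f (x + z)\<close>
  measurable on \<open>m \<Otimes>\<^sub>M m\<close> whenever \<open>f\<close> is Baire
  measurable.\<close>

lemma baire_projections [measurable]:
  "fst \<in> measurable (m \<Otimes>\<^sub>M m) baire" "snd \<in> measurable (m \<Otimes>\<^sub>M m) baire"
  by (rule measurable_imp_baire, simp cong: measurable_cong_sets add: sets_m)+

sublocale pair: pair_sigma_finite m m ..

text \<open>Averaging over an intermediate point \<open>y t\<close> with \<open>t \<in> S\<close>, where \<open>m(S) = 1\<close>, bounds a single
  displacement by displacements that are integrated over \<open>S\<^sup>2\<close>.\<close>

lemma displacement_le:
  fixes f :: "'a \<Rightarrow> complex"
  assumes S1: "emeasure m S = 1" and f [measurable]: "f \<in> borel_measurable baire" and s: "s \<in> S"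
  shows "(\<integral>\<^sup>+y. indicator ((+) x ` word_power S k) y * sqdist (f (y + s)) (f y) \<partial>m)
    \<le> 4 * (\<integral>\<^sup>+y. indicator ((+) x ` word_power S (Suc k)) y *
        (\<integral>\<^sup>+u. indicator (word_power S 2) u * sqdist (f (y + u)) (f y) \<partial>m) \<partial>m)"
proof -
  define D where "D = (+) x ` word_power S k"
  define D' where "D' = (+) x ` word_power S (Suc k)"
  define E where "E = (\<integral>\<^sup>+y. indicator D' y * (\<integral>\<^sup>+u. indicator (word_power S 2) u * sqdist (f (y + u)) (f y) \<partial>m) \<partial>m)"
  have [measurable]: "D \<in> sets borel" "D' \<in> sets borel" "S \<in> sets borel" "word_power S 2 \<in> sets borel"
    unfolding D_def D'_def using compact_S by (auto intro: translate_sets)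
  have fb [measurable]: "f \<in> borel_measurable borel" by (rule measurable_baire_imp_borel) fact
  have [measurable]: "(\<lambda>p. f (fst p + (h (snd p)))) \<in> borel_measurable (m \<Otimes>\<^sub>M m)"
    "(\<lambda>p. f (snd p + (h (fst p)))) \<in> borel_measurable (m \<Otimes>\<^sub>M m)"
    if [measurable]: "h \<in> measurable baire baire" for h
    by measurable
  have E: "E = (\<integral>\<^sup>+y. \<integral>\<^sup>+u. indicator D' y * (indicator (word_power S 2) u * sqdist (f (y + u)) (f y)) \<partial>m \<partial>m)"
    unfolding E_def by (intro nn_integral_cong nn_integral_cmult[symmetric]) measurable
  \<comment> \<open>The two legs of the detour through \<open>y + t\<close>: \<open>A\<close> goes
    from there to \<open>y + s\<close>, and \<open>B\<close> comes from \<open>y\<close>.\<close>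
  define A where "A t y = indicator S t * (indicator D y * sqdist (f (y + s)) (f (y + t)))" for t y
  define B where "B t y = indicator S t * (indicator D y * sqdist (f (y + t)) (f y))" for t y
  have D_D': "y \<in> D \<Longrightarrow> y \<in> D'" for y
    using word_power_mono[OF zero_S, of k "Suc k"] by (auto simp: D_def D'_def)
  have S_S2: "t \<in> S \<Longrightarrow> t \<in> word_power S 2" for t
    using word_power_mono[OF zero_S, of "Suc 0" 2] by auto
  have [measurable]: "case_prod A \<in> borel_measurable (m \<Otimes>\<^sub>M m)" "case_prod B \<in> borel_measurable (m \<Otimes>\<^sub>M m)"
    unfolding A_def B_def split_beta' by measurable
  have [measurable]: "A t \<in> borel_measurable m" "B t \<in> borel_measurable m" for t
    unfolding A_def B_def by measurable
  have B_le: "(\<integral>\<^sup>+t. \<integral>\<^sup>+y. B t y \<partial>m \<partial>m) \<le> E"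
  proof -
    have "(\<integral>\<^sup>+t. \<integral>\<^sup>+y. B t y \<partial>m \<partial>m) = (\<integral>\<^sup>+y. \<integral>\<^sup>+t. B t y \<partial>m \<partial>m)"
      by (rule pair.Fubini'[symmetric]) simp
    also have "\<dots> \<le> E"
      unfolding E by (intro nn_integral_mono) (auto simp: B_def indicator_def D_D' S_S2)
    finally show ?thesis .
  qed
  have A_le: "(\<integral>\<^sup>+t. \<integral>\<^sup>+y. A t y \<partial>m \<partial>m) \<le> E"
  proof -
    \<comment> \<open>\<open>A\<close> after shifting \<open>y\<close> by \<open>- t\<close>: the
      base point moves to \<open>y\<close>, now in the larger set \<open>D'\<close>, and the
      displacement becomes \<open>- t + s\<close>.\<close>
    define A' where "A' t y = indicator D' y * (indicator S t * sqdist (f (y + (- t + s))) (f y))" for t y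
    have A'_meas [measurable]: "case_prod A' \<in> borel_measurable (m \<Otimes>\<^sub>M m)"
      unfolding A'_def split_beta' by measurable
    have "(\<integral>\<^sup>+y. A t y \<partial>m) \<le> (\<integral>\<^sup>+y. A' t y \<partial>m)" for t
    proof -
      have "(\<integral>\<^sup>+y. A t y \<partial>m) = (\<integral>\<^sup>+y. A t (y + - t) \<partial>m)"
        by (rule nn_integral_right[symmetric]) measurable
      also have "\<dots> \<le> (\<integral>\<^sup>+y. A' t y \<partial>m)"
      proof (rule nn_integral_mono)
        fix y
        have "y \<in> D'" if "t \<in> S" "y + - t \<in> D"
        proof -
          have "- x + (y + - t) + t \<in> word_power S (k + Suc 0)"
            using that by (intro word_power_add) (auto simp: D_def mem_translate_iff)
          then show ?thesis by (simp add: D'_def mem_translate_iff add.assoc)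
        qed
        then show "A t (y + - t) \<le> A' t y"
          unfolding A_def A'_def add.assoc[symmetric] by (auto simp: indicator_def)
      qed
      finally show ?thesis .
    qed
    then have "(\<integral>\<^sup>+t. \<integral>\<^sup>+y. A t y \<partial>m \<partial>m) \<le> (\<integral>\<^sup>+t. \<integral>\<^sup>+y. A' t y \<partial>m \<partial>m)" by (rule nn_integral_mono)
    also have "\<dots> = (\<integral>\<^sup>+y. \<integral>\<^sup>+t. A' t y \<partial>m \<partial>m)"
      by (rule pair.Fubini'[symmetric]) simp
    also have "\<dots> \<le> E"
      unfolding E_def
    proof (rule nn_integral_mono)
      fix y
      have "(\<integral>\<^sup>+t. A' t y \<partial>m) = indicator D' y * (\<integral>\<^sup>+t. indicator S t * sqdist (f (y + (- t + s))) (f y) \<partial>m)"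
        unfolding A'_def by (intro nn_integral_cmult) measurable
      \<comment> \<open>Inversion and then a right shift by \<open>s\<close> turn the displacement
        \<open>- t + s\<close> into the integration variable itself. The condition left on it places
        it in S^2.\<close>
      also have "(\<integral>\<^sup>+t. indicator S t * sqdist (f (y + (- t + s))) (f y) \<partial>m)
          = (\<integral>\<^sup>+t. indicator S (- t) * sqdist (f (y + (t + s))) (f y) \<partial>m)"
        using nn_integral_uminus[of "\<lambda>t. indicator S (- t) * sqdist (f (y + (t + s))) (f y)"] by simp
      also have "\<dots> = (\<integral>\<^sup>+t. indicator S (- (t + - s)) * sqdist (f (y + t)) (f y) \<partial>m)"
      proof -
        have [measurable]: "(\<lambda>t. - (t + - s)) \<in> measurable borel borel"
          by (intro borel_measurable_continuous_onI continuous_on_minus continuous_intros)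
        have "(\<integral>\<^sup>+t. indicator S (- (t + s + - s)) * sqdist (f (y + (t + s))) (f y) \<partial>m)
            = (\<integral>\<^sup>+t. indicator S (- (t + - s)) * sqdist (f (y + t)) (f y) \<partial>m)"
          by (rule nn_integral_right) measurable
        then show ?thesis by (simp add: add.assoc)
      qed
      also have "\<dots> \<le> (\<integral>\<^sup>+u. indicator (word_power S 2) u * sqdist (f (y + u)) (f y) \<partial>m)"
      proof (rule nn_integral_mono)
        fix t
        have "t \<in> word_power S 2" if "- (t + - s) \<in> S"
        proof -
          have "- (- (t + - s)) \<in> S" using that uminus_S by blast
          then have "- (- (t + - s)) + s \<in> word_power S (Suc 0 + Suc 0)"
            using s by (intro word_power_add) auto
          then show ?thesis by (simp add: add.assoc numeral_2_eq_2)
        qed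
        then show "indicator S (- (t + - s)) * sqdist (f (y + t)) (f y)
            \<le> indicator (word_power S 2) t * sqdist (f (y + t)) (f y)"
          by (auto simp: indicator_def)
      qed
      finally show "(\<integral>\<^sup>+t. A' t y \<partial>m)
          \<le> indicator D' y * (\<integral>\<^sup>+u. indicator (word_power S 2) u * sqdist (f (y + u)) (f y) \<partial>m)"
        by (simp add: mult_left_mono)
    qed
    finally show ?thesis .
  qed
  \<comment> \<open>Since m(S) = 1, a quantity independent of \<open>t\<close> may be averaged over
    \<open>t \<in> S\<close>. The triangle inequality for squares then gives 2 E for each leg, hence
    the factor 4.\<close>
  have "(\<integral>\<^sup>+y. indicator D y * sqdist (f (y + s)) (f y) \<partial>m)
      = (\<integral>\<^sup>+t. (\<integral>\<^sup>+y. indicator D y * sqdist (f (y + s)) (f y) \<partial>m) * indicator S t \<partial>m)"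
    using S1 by (subst nn_integral_cmult_indicator) (simp_all add: sets_m)
  also have "\<dots> \<le> (\<integral>\<^sup>+t. \<integral>\<^sup>+y. 2 * A t y + 2 * B t y \<partial>m \<partial>m)"
  proof (rule nn_integral_mono)
    fix t
    show "(\<integral>\<^sup>+y. indicator D y * sqdist (f (y + s)) (f y) \<partial>m) * indicator S t \<le> (\<integral>\<^sup>+y. 2 * A t y + 2 * B t y \<partial>m)"
    proof (cases "t \<in> S")
      case True
      have "(\<integral>\<^sup>+y. indicator D y * sqdist (f (y + s)) (f y) \<partial>m) \<le> (\<integral>\<^sup>+y. 2 * A t y + 2 * B t y \<partial>m)"
        using True dist_square_triangle by (intro nn_integral_mono) (auto simp: A_def B_def indicator_def)
      then show ?thesis using True by simp
    qed simp
  qed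
  also have "\<dots> = (\<integral>\<^sup>+t. 2 * (\<integral>\<^sup>+y. A t y \<partial>m) + 2 * (\<integral>\<^sup>+y. B t y \<partial>m) \<partial>m)"
    by (simp add: nn_integral_add nn_integral_cmult)
  also have "\<dots> = 2 * (\<integral>\<^sup>+t. \<integral>\<^sup>+y. A t y \<partial>m \<partial>m) + 2 * (\<integral>\<^sup>+t. \<integral>\<^sup>+y. B t y \<partial>m \<partial>m)"
    by (subst nn_integral_add) (auto simp: nn_integral_cmult intro!: borel_measurable_nn_integral)
  also have "\<dots> \<le> 2 * E + 2 * E"
    using A_le B_le by (intro add_mono mult_left_mono) auto
  also have "\<dots> = 4 * E" by (simp add: distrib_right[symmetric])
  finally show ?thesis unfolding D_def D'_def E_def .
qed

text \<open>One factor \<open>length ss\<close> comes from Cauchy-Schwarz, the other from the number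
  of steps, each of which costs \<open>M\<close> after right translation by the preceding partial
  word. \<open>D\<close> has to contain the starting points of all steps.\<close>

lemma word_displacement_le:
  fixes f :: "'a \<Rightarrow> complex"
  assumes f [measurable]: "f \<in> borel_measurable borel"
    and M: "\<And>s. s \<in> S \<Longrightarrow> (\<integral>\<^sup>+y. indicator D y * sqdist (f (y + s)) (f y) \<partial>m) \<le> M"
    and D [measurable]: "D \<in> sets borel"
    and ss: "set ss \<subseteq> S"
    and path: "\<And>y i. y \<in> B \<Longrightarrow> y + sum_list ss \<in> B \<Longrightarrow> i < length ss \<Longrightarrow> y + sum_list (take i ss) \<in> D"
  shows "(\<integral>\<^sup>+y. indicator B y * (indicator B (y + sum_list ss) * sqdist (f (y + sum_list ss)) (f y)) \<partial>m)
    \<le> of_nat (length ss) * (of_nat (length ss) * M)"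
proof -
  let ?k = "length ss"
  define p where "p i = sum_list (take i ss)" for i
  have p_Suc: "p (Suc i) = p i + ss ! i" if "i < ?k" for i
    using that by (simp add: p_def take_Suc_conv_app_nth)
  have p0: "p 0 = 0" and pk: "p ?k = sum_list ss" by (simp_all add: p_def)
  \<comment> \<open>The i-th step seen from its own starting point \<open>y + p i\<close>;
    membership of that point in \<open>D\<close> replaces the two conditions involving
    \<open>B\<close>.\<close>
  let ?G = "\<lambda>i y. indicator D (y + p i) * sqdist (f (y + p i + ss ! i)) (f (y + p i))"
  have [measurable]: "?G i \<in> borel_measurable m" for i by measurable
  have "(\<integral>\<^sup>+y. indicator B y * (indicator B (y + sum_list ss) * sqdist (f (y + sum_list ss)) (f y)) \<partial>m)
      \<le> (\<integral>\<^sup>+y. of_nat ?k * (\<Sum>i<?k. ?G i y) \<partial>m)"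
  proof (rule nn_integral_mono)
    fix y
    show "indicator B y * (indicator B (y + sum_list ss) * sqdist (f (y + sum_list ss)) (f y))
        \<le> of_nat ?k * (\<Sum>i<?k. ?G i y)"
    proof (cases "y \<in> B \<and> y + sum_list ss \<in> B")
      case True
      have "sqdist (f (y + sum_list ss)) (f y) \<le> of_nat ?k * (\<Sum>i<?k. sqdist (f (y + p (Suc i))) (f (y + p i)))"
        using telescoping_square[of "\<lambda>i. f (y + p i)" ?k] by (simp add: p0 pk)
      also have "(\<Sum>i<?k. sqdist (f (y + p (Suc i))) (f (y + p i))) = (\<Sum>i<?k. ?G i y)"
      proof (intro sum.cong refl)
        fix i assume "i \<in> {..<?k}"
        then have "y + p i \<in> D" "p (Suc i) = p i + ss ! i"
          using True path p_Suc by (auto simp: p_def)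
        then show "sqdist (f (y + p (Suc i))) (f (y + p i)) = ?G i y" by (simp add: add.assoc)
      qed
      finally show ?thesis using True by simp
    qed auto
  qed
  also have "\<dots> = of_nat ?k * (\<integral>\<^sup>+y. (\<Sum>i<?k. ?G i y) \<partial>m)"
    by (rule nn_integral_cmult) measurable
  also have "\<dots> = of_nat ?k * (\<Sum>i<?k. \<integral>\<^sup>+y. ?G i y \<partial>m)"
    by (intro arg_cong[where f="(*) (of_nat ?k)"] nn_integral_sum) measurable
  also have "\<dots> \<le> of_nat ?k * (\<Sum>i<?k. M)"
  proof (intro mult_left_mono sum_mono)
    fix i assume "i \<in> {..<?k}"
    then have "ss ! i \<in> S" using ss by auto
    have "(\<integral>\<^sup>+y. ?G i y \<partial>m) = (\<integral>\<^sup>+y. indicator D y * sqdist (f (y + ss ! i)) (f y) \<partial>m)"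
      by (rule nn_integral_right) measurable
    also have "\<dots> \<le> M" by (rule M) fact
    finally show "(\<integral>\<^sup>+y. ?G i y \<partial>m) \<le> M" .
  qed simp
  finally show ?thesis by simp
qed

text \<open>With \<open>y = x + z\<close> the pairs of points of the ball are sorted by their
  displacement \<open>z\<close> in S^(2n). Each \<open>z\<close> contributes at most the bound for a
  word of length 2n, and integrating over \<open>z\<close> gives the last factor.\<close>

lemma pair_displacement_le:
  fixes f :: "'a \<Rightarrow> complex"
  assumes f [measurable]: "f \<in> borel_measurable baire"
    and M: "\<And>s. s \<in> S \<Longrightarrow>
      (\<integral>\<^sup>+y. indicator ((+) x\<^sub>0 ` word_power S (2 * n)) y * sqdist (f (y + s)) (f y) \<partial>m) \<le> M"
  shows "(\<integral>\<^sup>+x. indicator ((+) x\<^sub>0 ` word_power S n) x *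
      (\<integral>\<^sup>+y. indicator ((+) x\<^sub>0 ` word_power S n) y * sqdist (f x) (f y) \<partial>m) \<partial>m)
    \<le> of_nat (2 * n) * (of_nat (2 * n) * M) * emeasure m (word_power S (2 * n))"
proof -
  define B where "B = (+) x\<^sub>0 ` word_power S n"
  define W where "W = word_power S (2 * n)"
  define D where "D = (+) x\<^sub>0 ` W"
  have [measurable]: "B \<in> sets borel" "D \<in> sets borel" "W \<in> sets borel"
    unfolding B_def D_def W_def by (auto intro: translate_sets)
  have [measurable]: "f \<in> borel_measurable borel" by (rule measurable_baire_imp_borel) fact
  \<comment> \<open>The indicator of \<open>B\<close> at \<open>x + z\<close> need not be jointly
    measurable, so a Baire copy \<open>B'\<close> is used while the integrals are exchanged.\<close>
  obtain B' where B' [measurable]: "B' \<in> sets baire" and ae: "AE x in m. x \<in> B \<longleftrightarrow> x \<in> B'"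
    using borel_ae_baire[of B] by auto
  have [measurable]: "B' \<in> sets borel" using B' sets_baire_subset_borel by blast
  have inner_eq: "indicator B x * (\<integral>\<^sup>+y. indicator B y * sqdist (f x) (f y) \<partial>m)
      = (\<integral>\<^sup>+z. indicator W z * (indicator B x * (indicator B' (x + z) * sqdist (f (x + z)) (f x))) \<partial>m)" for x
  proof (cases "x \<in> B")
    case True
    have W: "- x + y \<in> W" if "y \<in> B" for y
    proof -
      have "- (- x\<^sub>0 + x) + (- x\<^sub>0 + y) \<in> word_power S (n + n)"
        using that True by (intro word_power_add word_power_uminus uminus_S) (auto simp: B_def mem_translate_iff)
      moreover have "- (- x\<^sub>0 + x) + (- x\<^sub>0 + y) = - x + y"
        by (simp add: minus_add add.assoc[symmetric])
      ultimately show ?thesis by (simp add: W_def mult_2)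
    qed
    have "(\<integral>\<^sup>+y. indicator B y * sqdist (f x) (f y) \<partial>m)
        = (\<integral>\<^sup>+y. indicator W (- x + y) * (indicator B' y * sqdist (f y) (f x)) \<partial>m)"
    proof (rule nn_integral_cong_AE)
      show "AE y in m. indicator B y * sqdist (f x) (f y) = indicator W (- x + y) * (indicator B' y * sqdist (f y) (f x))"
        using ae by eventually_elim (use W in \<open>auto simp: indicator_def norm_minus_commute\<close>)
    qed
    also have "\<dots> = (\<integral>\<^sup>+z. indicator W (- x + (x + z)) * (indicator B' (x + z) * sqdist (f (x + z)) (f x)) \<partial>m)"
      by (rule nn_integral_left[symmetric]) measurable
    finally show ?thesis using True by (simp add: add.assoc[symmetric])
  qed simp
  \<comment> \<open>For fixed \<open>z\<close> the set \<open>B\<close> is restored: right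
    translation preserves null sets, and the path argument needs both endpoints in \<open>B\<close>
    itself.\<close>
  have outer_eq: "(\<integral>\<^sup>+x. indicator B x * (indicator B' (x + z) * sqdist (f (x + z)) (f x)) \<partial>m)
      = (\<integral>\<^sup>+x. indicator B x * (indicator B (x + z) * sqdist (f (x + z)) (f x)) \<partial>m)" for z
  proof -
    have "(\<integral>\<^sup>+x. indicator B x * (indicator C (x + z) * sqdist (f (x + z)) (f x)) \<partial>m)
        = (\<integral>\<^sup>+y. indicator B (y + - z) * (indicator C y * sqdist (f y) (f (y + - z))) \<partial>m)"
      if [measurable]: "C \<in> sets borel" for C
      using nn_integral_right[of "\<lambda>x. indicator B (x + - z) * (indicator C x * sqdist (f x) (f (x + - z)))" z]
      by (simp add: add.assoc)
    moreover have "(\<integral>\<^sup>+y. indicator B (y + - z) * (indicator B y * sqdist (f y) (f (y + - z))) \<partial>m)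
        = (\<integral>\<^sup>+y. indicator B (y + - z) * (indicator B' y * sqdist (f y) (f (y + - z))) \<partial>m)"
    proof (rule nn_integral_cong_AE)
      show "AE y in m. indicator B (y + - z) * (indicator B y * sqdist (f y) (f (y + - z)))
          = indicator B (y + - z) * (indicator B' y * sqdist (f y) (f (y + - z)))"
        using ae by eventually_elim (simp add: indicator_def)
    qed
    ultimately show ?thesis by simp
  qed
  have word: "(\<integral>\<^sup>+x. indicator B x * (indicator B (x + z) * sqdist (f (x + z)) (f x)) \<partial>m)
      \<le> of_nat (2 * n) * (of_nat (2 * n) * M)" if z: "z \<in> W" for z
  proof -
    obtain ss where ss: "z = sum_list ss" "length ss = 2 * n" "set ss \<subseteq> S"
      using z by (auto simp: W_def word_power_def)
    have "y + sum_list (take i ss) \<in> D"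
      if y: "y \<in> B" "y + sum_list ss \<in> B" and i: "i < length ss" for y i
    \<comment> \<open>In the first half the point is within \<open>i\<close> letters of
      \<open>y\<close>, in the second half within \<open>2 * n - i\<close> letters of the endpoint.
      Either way its distance from \<open>x\<^sub>0\<close> is at most n + n.\<close>
    proof (cases "i \<le> n")
      case True
      have "sum_list (take i ss) \<in> word_power S i"
        unfolding word_power_def using ss i set_take_subset[of i ss] by (intro CollectI exI[of _ "take i ss"]) auto
      then have "(- x\<^sub>0 + y) + sum_list (take i ss) \<in> word_power S (n + i)"
        using y by (intro word_power_add) (auto simp: B_def mem_translate_iff)
      then have "(- x\<^sub>0 + y) + sum_list (take i ss) \<in> W"
        using word_power_mono[OF zero_S, of "n + i" "2 * n"] True by (auto simp: W_def)
      then show ?thesis by (simp add: D_def mem_translate_iff add.assoc)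
    next
      case False
      then have "n + (2 * n - i) \<le> 2 * n" by simp
      have "sum_list (drop i ss) \<in> word_power S (2 * n - i)"
        unfolding word_power_def using ss i set_drop_subset[of i ss] by (intro CollectI exI[of _ "drop i ss"]) auto
      then have "(- x\<^sub>0 + (y + sum_list ss)) + - sum_list (drop i ss) \<in> word_power S (n + (2 * n - i))"
        using y by (intro word_power_add word_power_uminus uminus_S) (auto simp: B_def mem_translate_iff)
      moreover have "sum_list ss = sum_list (take i ss) + sum_list (drop i ss)"
        by (metis append_take_drop_id sum_list_append)
      ultimately have "(- x\<^sub>0 + y) + sum_list (take i ss) \<in> word_power S (n + (2 * n - i))"
        by (simp add: add.assoc[symmetric])
      then have "(- x\<^sub>0 + y) + sum_list (take i ss) \<in> W"
        using word_power_mono[OF zero_S \<open>n + (2 * n - i) \<le> 2 * n\<close>] by (auto simp: W_def)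
      then show ?thesis by (simp add: D_def mem_translate_iff add.assoc)
    qed
    then show ?thesis
      using word_displacement_le[of f D M ss B] M ss \<open>D \<in> sets borel\<close>
      by (simp add: D_def W_def)
  qed
  have "(\<integral>\<^sup>+x. indicator B x * (\<integral>\<^sup>+y. indicator B y * sqdist (f x) (f y) \<partial>m) \<partial>m)
      = (\<integral>\<^sup>+x. \<integral>\<^sup>+z. indicator W z * (indicator B x * (indicator B' (x + z) * sqdist (f (x + z)) (f x))) \<partial>m \<partial>m)"
    by (simp only: inner_eq)
  also have "\<dots> = (\<integral>\<^sup>+z. \<integral>\<^sup>+x. indicator W z * (indicator B x * (indicator B' (x + z) * sqdist (f (x + z)) (f x))) \<partial>m \<partial>m)"
    by (rule pair.Fubini'[symmetric]) (unfold split_beta', measurable)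
  also have "\<dots> = (\<integral>\<^sup>+z. indicator W z * (\<integral>\<^sup>+x. indicator B x * (indicator B' (x + z) * sqdist (f (x + z)) (f x)) \<partial>m) \<partial>m)"
    by (intro nn_integral_cong nn_integral_cmult) measurable
  also have "\<dots> \<le> (\<integral>\<^sup>+z. of_nat (2 * n) * (of_nat (2 * n) * M) * indicator W z \<partial>m)"
  proof (rule nn_integral_mono)
    fix z
    show "indicator W z * (\<integral>\<^sup>+x. indicator B x * (indicator B' (x + z) * sqdist (f (x + z)) (f x)) \<partial>m)
        \<le> of_nat (2 * n) * (of_nat (2 * n) * M) * indicator W z"
      unfolding outer_eq using word[of z] by (cases "z \<in> W") simp_all
  qed
  also have "\<dots> = of_nat (2 * n) * (of_nat (2 * n) * M) * emeasure m W"
    by (rule nn_integral_cmult_indicator) (simp add: sets_m W_def)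
  finally show ?thesis unfolding B_def W_def .
qed

end

section \<open>The Poincare inequality on a ball\<close>

theorem proposition2p3:
  fixes S :: "'g::{topological_group_add,t2_space} set"
    and m \<mu> :: "'g measure"
    and \<phi> :: "'g \<Rightarrow> real"
    and f :: "'g \<Rightarrow> complex"
    and x\<^sub>0 :: 'g
    and c R :: real
  defines "B \<equiv> word_ball S x\<^sub>0 R"
    and "B2 \<equiv> word_ball S x\<^sub>0 (2 * R)"
    and "B3 \<equiv> word_ball S x\<^sub>0 (3 * R)"
  assumes "locally_compact_space (euclidean :: 'g topology)"
    and "compact_symmetric_generating_set S"
    and "left_haar_measure m"
    and "emeasure m S = 1"
    and "polynomial_growth S m"
    and "prob_space \<mu>"
    and "courteous S m \<mu>"
    and "continuous_density m \<mu> \<phi>"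
    and "c > 0"
    and "\<forall>s\<in>word_power S 2. c \<le> \<phi> s"
    and "R \<ge> 1"
    and "f \<in> borel_measurable borel"
    and "locally_integrable m f"
  shows "(\<integral>\<^sup>+ x\<in>B. ennreal ((cmod (f x - set_average m B f))\<^sup>2) \<partial>m)
    \<le> ennreal (inverse c * 32 * R\<^sup>2 * ((measure m B2)\<^sup>2 / (measure m B)\<^sup>2))
        * (\<integral>\<^sup>+ x\<in>B3. (gradient2 \<mu> f x)\<^sup>2 \<partial>m)"
proof -
  interpret compactly_generated_haar S m by standard fact+
  interpret unimodular_compactly_generated_haar S m
    by standard (rule right_invariant[OF \<open>emeasure m S = 1\<close> \<open>polynomial_growth S m\<close>])
  define n where "n = nat \<lfloor>R\<rfloor>"
  have n: "n \<ge> 1" "real n \<le> R" using \<open>R \<ge> 1\<close> unfolding n_def by linarith+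
  have B_eq: "B = (+) x\<^sub>0 ` word_power S n"
    unfolding B_def n_def using \<open>R \<ge> 1\<close> by (intro word_ball_eq) auto
  have B2_eq: "B2 = (+) x\<^sub>0 ` word_power S (nat \<lfloor>2 * R\<rfloor>)"
    unfolding B2_def using \<open>R \<ge> 1\<close> by (intro word_ball_eq) auto
  have B3_eq: "B3 = (+) x\<^sub>0 ` word_power S (nat \<lfloor>3 * R\<rfloor>)"
    unfolding B3_def using \<open>R \<ge> 1\<close> by (intro word_ball_eq) auto
  have compacts: "compact B" "compact B2"
    unfolding B_eq B2_eq using compact_word_power[OF compact_S]
    by (intro compact_continuous_image continuous_intros; simp)+
  have [measurable]: "B \<in> sets borel" unfolding B_eq by (intro translate_sets) simp
  define b where "b = measure m B"
  define b2 where "b2 = measure m B2"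
  define W where "W = word_power S (2 * n)"
  define w where "w = measure m W"
  have em: "emeasure m C = ennreal (measure m C)" if "compact C" for C
    using compact_finite[OF that] by (intro emeasure_eq_ennreal_measure) auto
  have b_em: "emeasure m B = ennreal b" and b2_em: "emeasure m B2 = ennreal b2"
    and w_em: "emeasure m W = ennreal w"
    unfolding b_def b2_def w_def W_def using em compacts compact_word_power[OF compact_S] by auto
  \<comment> \<open>\<open>S\<close> lies in S^n and m(S) = 1; this keeps the divisions by
    \<open>b\<close> legitimate.\<close>
  have b1: "1 \<le> b"
  proof -
    have "emeasure m S \<le> emeasure m (word_power S n)"
      using word_power_mono[OF zero_S, of "Suc 0" n] n by (intro emeasure_mono) (auto simp: sets_m)
    then have "ennreal 1 \<le> ennreal b"
      using \<open>emeasure m S = 1\<close> left_invariant[of "word_power S n" x\<^sub>0] by (simp add: B_eq flip: b_em)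
    then show ?thesis by (simp add: b_def)
  qed
  \<comment> \<open>Twice the integer part of \<open>R\<close> is at most the integer part of
    \<open>2 * R\<close>, and left invariance removes the centre.\<close>
  have w_b2: "w \<le> b2"
  proof -
    have "2 * n \<le> nat \<lfloor>2 * R\<rfloor>" using n by linarith
    then have "emeasure m W \<le> emeasure m (word_power S (nat \<lfloor>2 * R\<rfloor>))"
      unfolding W_def using word_power_mono[OF zero_S] by (intro emeasure_mono) (auto simp: sets_m)
    then have "ennreal w \<le> ennreal b2"
      using left_invariant[of "word_power S (nat \<lfloor>2 * R\<rfloor>)" x\<^sub>0] by (simp add: w_em B2_eq flip: b2_em)
    then show ?thesis by (simp add: b2_def)
  qed
  have b_w: "b \<le> w"
  proof -
    have "emeasure m (word_power S n) \<le> emeasure m W"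
      unfolding W_def using word_power_mono[OF zero_S, of n "2 * n"] by (intro emeasure_mono) (auto simp: sets_m)
    then have "ennreal b \<le> ennreal w"
      using left_invariant[of "word_power S n" x\<^sub>0] by (simp add: w_em B_eq flip: b_em)
    then show ?thesis by (simp add: w_def)
  qed

  \<comment> \<open>The displacement estimates need a Baire function; \<open>h\<close> has the same
    average and the same variance over \<open>B\<close> as \<open>f\<close>.\<close>
  obtain h where h [measurable]: "h \<in> borel_measurable baire" and ae: "AE x in m. f x = h x"
    using borel_fun_ae_baire_complex[OF \<open>f \<in> borel_measurable borel\<close>] by blast
  have [measurable]: "h \<in> borel_measurable borel" by (rule measurable_baire_imp_borel) fact
  have f_meas [measurable]: "f \<in> borel_measurable borel" by fact
  have f_int: "set_integrable m B f"
    using \<open>locally_integrable m f\<close> compacts by (simp add: locally_integrable_def)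
  have h_int: "set_integrable m B h"
    using f_int unfolding set_integrable_def
    by (rule integrable_cong_AE_imp) (use ae in \<open>auto elim: AE_mp\<close>)
  have avg_eq: "set_average m B f = set_average m B h"
    unfolding set_average_def set_lebesgue_integral_def
    by (intro arg_cong[where f="\<lambda>z. z /\<^sub>R measure m B"] integral_cong_AE) (use ae in \<open>auto elim: AE_mp\<close>)

  \<comment> \<open>The extra letter is the enlargement made by \<open>displacement_le\<close>. The
    radius fits into \<open>B3\<close> because 2n + 1 \<le> 3n \<le> 3R.\<close>
  define D where "D = (+) x\<^sub>0 ` word_power S (Suc (2 * n))"
  define G where "G = (\<integral>\<^sup>+x\<in>B3. (gradient2 \<mu> f x)\<^sup>2 \<partial>m)"
  define Q where "Q x = (\<integral>\<^sup>+u. indicator (word_power S 2) u * sqdist (h (x + u)) (h x) \<partial>m)" for x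
  define E where "E = (\<integral>\<^sup>+x. indicator D x * Q x \<partial>m)"
  have [measurable]: "D \<in> sets borel" unfolding D_def by (intro translate_sets) simp
  have D_B3: "D \<subseteq> B3"
  proof -
    have "Suc (2 * n) \<le> nat \<lfloor>3 * R\<rfloor>" using n by linarith
    then show ?thesis unfolding D_def B3_eq by (intro image_mono word_power_mono zero_S)
  qed
  have [measurable]: "word_power S 2 \<in> sets borel" by simp
  have [measurable]: "(\<lambda>p. h (fst p + snd p)) \<in> borel_measurable (m \<Otimes>\<^sub>M m)"
    by (rule measurable_compose[OF measurable_baire_add[OF baire_projections] h])
  have [measurable]: "Q \<in> borel_measurable m"
    unfolding Q_def by (rule borel_measurable_nn_integral) (unfold split_beta', measurable)
  \<comment> \<open>The density is at least \<open>c\<close> on S^2, and the integrand outside S^2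
    is nonnegative. Passing from \<open>h\<close> back to \<open>f\<close> uses
    \<open>f x = h x\<close>, and \<open>f (x + s) = h (x + s)\<close> for almost every
    \<open>s\<close>.\<close>
  have Q_le: "AE x in m. ennreal c * Q x \<le> (gradient2 \<mu> f x)\<^sup>2"
    using ae
  proof eventually_elim
    case (elim x)
    have \<mu>: "\<mu> = density m (\<lambda>s. ennreal (\<phi> s))" and "continuous_on UNIV \<phi>"
      using \<open>continuous_density m \<mu> \<phi>\<close> by (auto simp: continuous_density_def)
    then have [measurable]: "\<phi> \<in> borel_measurable borel" by (intro borel_measurable_continuous_onI)
    have ae_x: "AE s in m. f (x + s) = h (x + s)"
    proof -
      have "(\<integral>\<^sup>+s. indicator {y. f y \<noteq> h y} (x + s) \<partial>m) = (\<integral>\<^sup>+s. indicator {y. f y \<noteq> h y} s \<partial>m)"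
        by (rule nn_integral_left) measurable
      also have "\<dots> = 0"
        using ae by (subst nn_integral_0_iff_AE) (auto simp: indicator_def elim: AE_mp)
      finally show ?thesis
        by (subst (asm) nn_integral_0_iff_AE) (auto simp: indicator_def)
    qed
    have "ennreal c * Q x = (\<integral>\<^sup>+u. ennreal c * (indicator (word_power S 2) u * sqdist (h (x + u)) (h x)) \<partial>m)"
      unfolding Q_def by (rule nn_integral_cmult[symmetric]) measurable
    also have "\<dots> \<le> (\<integral>\<^sup>+s. ennreal (\<phi> s) * sqdist (f (x + s)) (f x) \<partial>m)"
    proof (rule nn_integral_mono_AE)
      show "AE s in m. ennreal c * (indicator (word_power S 2) s * sqdist (h (x + s)) (h x))
          \<le> ennreal (\<phi> s) * sqdist (f (x + s)) (f x)"
        using ae_x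
        by eventually_elim
          (use \<open>\<forall>s\<in>word_power S 2. c \<le> \<phi> s\<close> elim in \<open>auto simp: indicator_def intro!: mult_right_mono ennreal_leI\<close>)
    qed
    also have "\<dots> = (\<integral>\<^sup>+s. sqdist (f (x + s)) (f x) \<partial>\<mu>)"
      unfolding \<mu> by (rule nn_integral_density[symmetric]) measurable
    finally show ?case by (simp add: gradient2_square)
  qed
  have E_le: "ennreal c * E \<le> G"
  proof -
    have "ennreal c * E = (\<integral>\<^sup>+x. ennreal c * (indicator D x * Q x) \<partial>m)"
      unfolding E_def by (rule nn_integral_cmult[symmetric]) measurable
    also have "\<dots> \<le> G"
      unfolding G_def
    proof (rule nn_integral_mono_AE)
      show "AE x in m. ennreal c * (indicator D x * Q x) \<le> (gradient2 \<mu> f x)\<^sup>2 * indicator B3 x"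
        using Q_le by eventually_elim (use D_B3 in \<open>auto simp: indicator_def\<close>)
    qed
    finally show ?thesis .
  qed
  have E_le': "E \<le> ennreal (inverse c) * G"
  proof -
    have "E = ennreal (inverse c) * (ennreal c * E)"
      using \<open>c > 0\<close> by (simp add: mult.assoc[symmetric] flip: ennreal_mult)
    then show ?thesis using mult_left_mono[OF E_le, of "ennreal (inverse c)"] by simp
  qed

  \<comment> \<open>The one-letter bound \<open>M\<close> is \<open>4 * E\<close>, from
    \<open>displacement_le\<close> with \<open>k = 2 * n\<close>.\<close>
  have pairs: "(\<integral>\<^sup>+x. indicator B x * (\<integral>\<^sup>+y. indicator B y * sqdist (h x) (h y) \<partial>m) \<partial>m)
      \<le> of_nat (2 * n) * (of_nat (2 * n) * (4 * E)) * ennreal w"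
    unfolding B_eq w_em[symmetric] W_def
  proof (rule pair_displacement_le[OF h])
    fix s assume s: "s \<in> S"
    show "(\<integral>\<^sup>+y. indicator ((+) x\<^sub>0 ` word_power S (2 * n)) y * sqdist (h (y + s)) (h y) \<partial>m) \<le> 4 * E"
      using displacement_le[OF \<open>emeasure m S = 1\<close> h s, of x\<^sub>0 "2 * n"] by (simp add: E_def D_def Q_def)
  qed
  have [measurable]: "(\<lambda>x. \<integral>\<^sup>+y. indicator B y * sqdist (h x) (h y) \<partial>m) \<in> borel_measurable m"
    by (rule borel_measurable_nn_integral) measurable
  have "(\<integral>\<^sup>+x\<in>B. ennreal ((cmod (f x - set_average m B f))\<^sup>2) \<partial>m)
      = (\<integral>\<^sup>+x\<in>B. ennreal ((cmod (h x - set_average m B h))\<^sup>2) \<partial>m)"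
    by (rule nn_integral_cong_AE) (use ae avg_eq in \<open>auto elim: AE_mp\<close>)
  also have "\<dots> \<le> (\<integral>\<^sup>+x. indicator B x * (\<integral>\<^sup>+y. indicator B y * sqdist (h x) (h y) \<partial>m) * inverse (ennreal b) \<partial>m)"
  proof (rule nn_integral_mono)
    fix x
    have "ennreal ((cmod (h x - set_average m B h))\<^sup>2)
        \<le> (\<integral>\<^sup>+y\<in>B. sqdist (h x) (h y) \<partial>m) / ennreal (measure m B)"
      using b1 b_em by (intro square_average_le h_int) (auto simp: sets_m b_def)
    then show "ennreal ((cmod (h x - set_average m B h))\<^sup>2) * indicator B x
        \<le> indicator B x * (\<integral>\<^sup>+y. indicator B y * sqdist (h x) (h y) \<partial>m) * inverse (ennreal b)"
      by (auto simp: indicator_def divide_ennreal_def b_def mult.commute)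
  qed
  also have "\<dots> = (\<integral>\<^sup>+x. indicator B x * (\<integral>\<^sup>+y. indicator B y * sqdist (h x) (h y) \<partial>m) \<partial>m) * inverse (ennreal b)"
    by (rule nn_integral_multc) measurable
  also have "\<dots> \<le> (of_nat (2 * n) * (of_nat (2 * n) * (4 * E)) * ennreal w) * inverse (ennreal b)"
    using pairs by (rule mult_right_mono) simp
  also have "\<dots> \<le> (of_nat (2 * n) * (of_nat (2 * n) * (4 * (ennreal (inverse c) * G))) * ennreal w) * inverse (ennreal b)"
    using E_le' by (intro mult_right_mono mult_left_mono) auto
  also have "\<dots> = ennreal (real (2 * n) * real (2 * n) * 4 * inverse c * w * inverse b) * G"
    using b1 b_w \<open>c > 0\<close>
    by (simp add: ennreal_of_nat_eq_real_of_nat inverse_ennreal ennreal_mult ac_simps)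
  also have "\<dots> \<le> ennreal (inverse c * 32 * R\<^sup>2 * (b2\<^sup>2 / b\<^sup>2)) * G"
  proof (intro mult_right_mono ennreal_leI)
    \<comment> \<open>Only the first power of the volume ratio arises; since the ratio is at least
      1, it is bounded by its square.\<close>
    have "1 \<le> b2 / b" using b1 b_w w_b2 by (simp add: field_simps)
    then have "b2 / b \<le> b2\<^sup>2 / b\<^sup>2"
      using power_increasing[of 1 2 "b2 / b"] by (simp add: power_divide)
    moreover have "w * inverse b \<le> b2 / b" using w_b2 b1 by (simp add: divide_inverse mult_right_mono)
    ultimately have wb: "w * inverse b \<le> b2\<^sup>2 / b\<^sup>2" by simp
    have nR: "(real n)\<^sup>2 \<le> R\<^sup>2" using n by (intro power_mono) auto
    \<comment> \<open>The constant obtained is 16 = 2 * 2 * 4, the squared word length 2n times the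
      4 of the detour; it is then relaxed to 32.\<close>
    have "real (2 * n) * real (2 * n) * 4 * inverse c * w * inverse b
        = inverse c * (16 * (real n)\<^sup>2) * (w * inverse b)" by (simp add: power2_eq_square)
    also have "\<dots> \<le> inverse c * (32 * R\<^sup>2) * (b2\<^sup>2 / b\<^sup>2)"
      using nR wb \<open>c > 0\<close> b1 b_w by (intro mult_mono) auto
    finally show "real (2 * n) * real (2 * n) * 4 * inverse c * w * inverse b
        \<le> inverse c * 32 * R\<^sup>2 * (b2\<^sup>2 / b\<^sup>2)" by simp
  qed simp
  finally show ?thesis unfolding b_def b2_def G_def .
qed

end
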